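(* With $l=2,3,5$ corresponding to $n=6,7,8$ respectively in item (8), the circular measures of the finite ADE graphs (rooted as described in the context) are given by: (1) $A_{n-1}\to\alpha_n$, for $n\ge 3$. (2) $\tilde{A}_{2n}\to d_n$, for $n\ge 1$. (3) $D_{n+1}\to\alpha_n'$, for $n\ge 2$. (4) $\tilde{D}_{n+2}\to (d_n+d_1')/2$, for $n\ge 2$. (5) $E_6\to (d_2''+2\alpha_2''+3d_1''')/6$. (6) $E_7\to (2\beta_3''+d_1')/3$. (7) $E_8\to (2\alpha_5''+2\gamma_5''-d_1'')/3$. (8) $\tilde{E}_n\to \alpha_{l+1}+(d_l-d_{l+1})/2$, for $(n,l)=(6,2),(7,3),(8,5)$.
   Context: Circular measure. Let $X$ be a finite rooted bipartite graph (multiple edges allowed) and let $c_k$ be the number of loops of length $2k$ on $X$ based at the root (counted with edge multiplicity). The real measure of $X$ is the probability measure $\mu$ on $[0,\infty)$ with $\int x^k\,d\mu(x)=c_k$ for all $k\ge 0$; equivalently, it is the spectral measure of the square of the adjacency matrix with respect to the (root, root) entry. Write $\mu=\sum_i p_i\delta_{x_i}$. For each $i$ the equation $(q+q^{-1})^2=x_i$ has the solutions $q_i,q_i^{-1},-q_i,-q_i^{-1}$ (with multiplicity), and the circular measure of $X$ is $$\varepsilon=\frac14\sum_i p_i(\delta_{q_i}+\delta_{q_i^{-1}}+\delta_{-q_i}+\delta_{-q_i^{-1}}).$$ Measures. For $n\ge1$: $d_n$ is the uniform probability measure on the $2n$-th roots of unity; $d_n'=2d_{2n}-d_n$ is the uniform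 measure on the odd $4n$-roots of unity; $d_n''=(3d_{3n}'-d_n')/2$ is the uniform measure on the $12n$-roots of unity of order $6k\pm1$ (i.e. $e^{2\pi i m/(12n)}$ with $m\equiv\pm1$ mod $6$); $d_n'''=(3d_{3n}-d_n)/2$ is the uniform measure on the $6n$-roots of unity of order $3k\pm 1$ (i.e. $e^{2\pi i m/(6n)}$ with $m\equiv\pm1$ mod $3$). For a function $\lambda:\mathbb T\to\mathbb R$ on the unit circle, $\lambda_n=\lambda\,d_n$, $\lambda_n'=\lambda\,d_n'$, $\lambda_n''=\lambda\,d_n''$ (measures with density $\lambda$ with respect to $d_n,d_n',d_n''$). The densities are $\alpha(q)={\rm Re}(1-q^2)$, $\beta(q)={\rm Re}(1-q^4)$, $\gamma(q)={\rm Re}(1-q^6)$. Graphs. $A_n$ ($n\ge2$): path with $n$ vertices, rooted at an end vertex. $D_n$ ($n\ge 3$): path $v_1,\dots,v_{n-2}$ with two extra leaves attached to $v_{n-2}$, rooted at $v_1$. $\tilde A_{2n}$ ($n\ge1$): cycle with $2n$ vertices, rooted at a vertex (for $n=1$: two vertices joined by a double edge). $\tilde D_n$ ($n\ge4$): path $v_1,\dots,v_{n-3}$ with two extra leaves attached to $v_1$ and two extra leaves attached to $v_{n-3}$ (for $n=4$: one vertex with four leaves), rooted at one of the four leaves. The exceptional graphs are trees with one central vertex and three legs (paths attached to the central vertex), with the following numbers of vertices in the legs: $E_6$: $(2,1,2)$; $E_7$: $(3,1,2)$; $E_8$: $(4,1,2)$; $\tilde E_6$: $(2,2,2)$; $\tilde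 E_7$: $(3,1,3)$; $\tilde E_8$: $(5,1,2)$; each is rooted at the end vertex of a leg of maximal length. *)

theory Defs
  imports "HOL-Probability.Probability"
begin

text \<open>An edge is the set of its endpoints; multiple edges are multiplicities in the multiset.\<close>

record 'v rooted_graph =
  verts :: "'v set"
  edges :: "'v set multiset"
  root :: 'v

text \<open>
  Each vertex sequence \<open>v\<^sub>0, \<dots>, v\<^sub>m\<close> starting and ending at the root contributes one loop for every
  choice of an edge between each two consecutive vertices.
\<close>

definition loops :: "'v rooted_graph \<Rightarrow> nat \<Rightarrow> nat" where
  "loops X m =
    (\<Sum>vs | length vs = Suc m \<and> set vs \<subseteq> verts X \<and> hd vs = root X \<and> last vs = root X.
       \<Prod>i<m. count (edges X) {vs ! i, vs ! Suc i})"

definition real_measure :: "'v rooted_graph \<Rightarrow> real measure" where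
  "real_measure X = (THE M. prob_space M \<and> sets M = sets borel \<and> (AE x in M. 0 \<le> x) \<and>
     (\<forall>k. has_bochner_integral M (\<lambda>x. x ^ k) (real (loops X (2 * k)))))"

text \<open>
  Finitely supported signed measures on the complex plane are represented by their values on all
  subsets of the plane, i.e. by functions of type \<open>complex set \<Rightarrow> real\<close>.
\<close>

definition dirac :: "complex \<Rightarrow> complex set \<Rightarrow> real" where
  "dirac z = (\<lambda>B. indicator B z)"

text \<open>
  The condition \<open>q \<noteq> 0\<close> is needed because \<open>inverse 0 = 0\<close>. All solutions are
  \<open>q, 1/q, -q, -1/q\<close>, so \<open>circular_measure\<close> does not depend on the choice made here; if
  these coincide, the repetition in the sum below accounts for the multiplicity.
\<close>

definition q_of :: "real \<Rightarrow> complex" where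
  "q_of x = (SOME q. q \<noteq> 0 \<and> (q + inverse q)\<^sup>2 = complex_of_real x)"

text \<open>
  The sum ranges over the atoms of the real measure, which is supported on finitely many points
  because the graph is finite.
\<close>

definition circular_measure :: "'v rooted_graph \<Rightarrow> complex set \<Rightarrow> real" where
  "circular_measure X = (\<lambda>B. 1 / 4 *
     (\<Sum>x | measure (real_measure X) {x} \<noteq> 0. measure (real_measure X) {x} *
        (dirac (q_of x) B + dirac (inverse (q_of x)) B
         + dirac (- q_of x) B + dirac (- inverse (q_of x)) B)))"

text \<open>The four families are used for \<open>n \<ge> 1\<close> only.\<close>

definition d :: "nat \<Rightarrow> complex set \<Rightarrow> real" where
  "d n = (\<lambda>B. measure_pmf.prob (pmf_of_set {z. z ^ (2 * n) = 1}) B)"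

definition d' :: "nat \<Rightarrow> complex set \<Rightarrow> real" where
  "d' n = (\<lambda>B. 2 * d (2 * n) B - d n B)"

definition d'' :: "nat \<Rightarrow> complex set \<Rightarrow> real" where
  "d'' n = (\<lambda>B. (3 * d' (3 * n) B - d' n B) / 2)"

definition d''' :: "nat \<Rightarrow> complex set \<Rightarrow> real" where
  "d''' n = (\<lambda>B. (3 * d (3 * n) B - d n B) / 2)"

text \<open>The integral of \<open>f\<close> over \<open>B\<close> with respect to the finitely supported signed measure \<open>m\<close>.\<close>

definition weighted :: "(complex \<Rightarrow> real) \<Rightarrow> (complex set \<Rightarrow> real) \<Rightarrow> complex set \<Rightarrow> real" where
  "weighted f m = (\<lambda>B. \<Sum>q | q \<in> B \<and> m {q} \<noteq> 0. f q * m {q})"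

definition \<alpha> :: "complex \<Rightarrow> real" where
  "\<alpha> q = Re (1 - q ^ 2)"

definition \<beta> :: "complex \<Rightarrow> real" where
  "\<beta> q = Re (1 - q ^ 4)"

definition \<gamma> :: "complex \<Rightarrow> real" where
  "\<gamma> q = Re (1 - q ^ 6)"

definition graph_A :: "nat \<Rightarrow> nat rooted_graph" where
  "graph_A n =
    \<lparr>verts = {1..n}, edges = image_mset (\<lambda>i. {i, Suc i}) (mset_set {1..<n}), root = 1\<rparr>"

text \<open>The path is \<open>1, \<dots>, n - 2\<close>; the extra leaves are \<open>n - 1\<close> and \<open>n\<close>.\<close>

definition graph_D :: "nat \<Rightarrow> nat rooted_graph" where
  "graph_D n =
    \<lparr>verts = {1..n},
     edges = image_mset (\<lambda>i. {i, Suc i}) (mset_set {1..<n - 2})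
       + {# {n - 2, n - 1}, {n - 2, n} #},
     root = 1\<rparr>"

text \<open>
  The cycle on \<open>m\<close> vertices; for \<open>m = 2\<close> the edge \<open>{0, 1}\<close> occurs twice in the multiset.
\<close>

definition affine_A :: "nat \<Rightarrow> nat rooted_graph" where
  "affine_A m =
    \<lparr>verts = {0..<m}, edges = image_mset (\<lambda>i. {i, Suc i mod m}) (mset_set {0..<m}), root = 0\<rparr>"

text \<open>
  The path is \<open>1, \<dots>, n - 3\<close>; the extra leaves are \<open>n - 2\<close>, \<open>n - 1\<close> at the vertex \<open>1\<close> and
  \<open>n\<close>, \<open>n + 1\<close> at the vertex \<open>n - 3\<close>.
\<close>

definition affine_D :: "nat \<Rightarrow> nat rooted_graph" where
  "affine_D n =
    \<lparr>verts = {1..n + 1},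
     edges = image_mset (\<lambda>i. {i, Suc i}) (mset_set {1..<n - 3})
       + {# {1, n - 2}, {1, n - 1}, {n - 3, n}, {n - 3, n + 1} #},
     root = n - 2\<rparr>"

text \<open>
  Vertex number \<open>i\<close> on leg \<open>j\<close>, counted from the centre \<open>(0, 0)\<close>, which is vertex number \<open>0\<close> of
  every leg.
\<close>

definition leg_vertex :: "nat \<Rightarrow> nat \<Rightarrow> nat \<times> nat" where
  "leg_vertex j i = (if i = 0 then (0, 0) else (j, i))"

definition leg_edges :: "nat \<Rightarrow> nat \<Rightarrow> (nat \<times> nat) set multiset" where
  "leg_edges j l = image_mset (\<lambda>i. {leg_vertex j i, leg_vertex j (Suc i)}) (mset_set {0..<l})"

text \<open>
  The root is the end of the first leg, which has maximal length in all cases below; where another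
  leg has the same length, the two are exchanged by a graph automorphism.
\<close>

definition three_legs :: "nat \<Rightarrow> nat \<Rightarrow> nat \<Rightarrow> (nat \<times> nat) rooted_graph" where
  "three_legs a b c =
    \<lparr>verts = leg_vertex 1 ` {0..a} \<union> leg_vertex 2 ` {0..b} \<union> leg_vertex 3 ` {0..c},
     edges = leg_edges 1 a + leg_edges 2 b + leg_edges 3 c,
     root = leg_vertex 1 a\<rparr>"

definition "graph_E6 = three_legs 2 1 2"
definition "graph_E7 = three_legs 3 1 2"
definition "graph_E8 = three_legs 4 1 2"
definition "affine_E6 = three_legs 2 2 2"
definition "affine_E7 = three_legs 3 1 3"
definition "affine_E8 = three_legs 5 1 2"

end

theory Submission
  imports Defs
begin

text \<open>
  Let \<open>m\<close> be the measure that is claimed to be the circular measure of a graph. In all cases it is a positive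
  measure on the \<open>2 N\<close>-th roots of unity for some \<open>N\<close>, invariant under \<open>q \<mapsto> -q\<close> and \<open>q \<mapsto> 1/q\<close>. Its image
  under \<open>q \<mapsto> (q + 1/q)\<^sup>2\<close> is a finitely supported measure on the half-line, and such a measure is determined by
  its moments (\<open>finite_support_determined_by_moments\<close>). As \<open>m\<close> is constant on the fibres of this map, it is the
  circular measure as soon as the sums of \<open>m {q} (q + 1/q)\<^sup>2\<^sup>k\<close> count the loops of length \<open>2 k\<close>
  (\<open>circular_measure_eq_of_moments\<close>).

  These moments are computed by diagonalising the adjacency matrix explicitly. For every \<open>q\<close> one writes down a
  function \<open>v \<mapsto> F v q\<close> on the vertices that is an eigenfunction with eigenvalue \<open>q + 1/q\<close> and has the value
  \<open>m {q}\<close> at the root. If the sum of \<open>F v q\<close> over \<open>q\<close> vanishes for every other vertex \<open>v\<close>, then the moments of \<open>m\<close>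
  count loops (\<open>circular_measure_eqI\<close>).

  Along a path the eigenvalue equation is the recurrence of the Chebyshev polynomials in \<open>q + 1/q\<close>, which are
  solved by powers of \<open>q\<close>. The condition that \<open>q\<close> is a root of unity of the right order is the eigenvalue
  equation at the far end, and orthogonality holds because the sum of \<open>q\<^sup>k\<close> over all \<open>2 n\<close>-th roots of unity vanishes
  unless \<open>2 n\<close> divides \<open>k\<close>. For the two finite families, the eigenfunctions are sines, normalised by the density
  \<open>\<alpha>\<close>; for the cycles they are characters. For the affine family with four leaves they are cosines, with an additional
  eigenfunction of eigenvalue zero that is the difference of twin leaves and explains the summand
  \<open>d' 1\<close>.

  For the exceptional graphs the recurrence is followed from the root to the centre and continued along the other
  two legs (\<open>circular_measure_three_legs\<close>). The equations at the ends of these legs say that the eigenvalues are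
  roots of the characteristic polynomial, whose factors are cyclotomic polynomials in \<open>q\<close>. In three of these graphs
  the recurrence does not determine the values beyond the centre if the eigenvalue is zero, at \<open>q = i\<close> and \<open>q = -i\<close>; there the
  eigenfunction is corrected by a multiple of \<open>d' 1\<close>.
\<close>

section \<open>Measures determined by their moments\<close>

lemma interpolating_polynomial:
  fixes h :: "real \<Rightarrow> real"
  assumes "finite T"
  shows "\<exists>Q. \<forall>y\<in>T. poly Q y = h y"
  using assms
proof (induction T)
  case empty
  show ?case by simp
next
  case (insert y T)
  then obtain Q where Q: "\<forall>z\<in>T. poly Q z = h z" by blast
  define R where "R = (\<Prod>z\<in>T. [:-z, 1:])"
  have R0: "poly R z = 0" if "z \<in> T" for z
    using that insert.hyps by (auto simp: R_def poly_prod)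
  have Ry: "poly R y \<noteq> 0"
    using insert.hyps by (auto simp: R_def poly_prod)
  have "\<forall>z\<in>insert y T. poly (Q + smult ((h y - poly Q y) / poly R y) R) z = h z"
    using Q R0 Ry by auto
  then show ?case by blast
qed

lemma has_bochner_integral_poly:
  fixes M :: "real measure"
  assumes "\<And>k. has_bochner_integral M (\<lambda>x. x ^ k) (c k)"
  shows "has_bochner_integral M (poly Q) (\<Sum>k\<le>degree Q. coeff Q k * c k)"
proof -
  have "has_bochner_integral M (\<lambda>x. \<Sum>k\<le>degree Q. coeff Q k * x ^ k) (\<Sum>k\<le>degree Q. coeff Q k * c k)"
    by (intro has_bochner_integral_sum has_bochner_integral_mult_right assms)
  then show ?thesis by (simp add: poly_altdef[abs_def])
qed

text \<open>
  Uniqueness in the moment problem fails in general, but it holds for every finitely supported measure,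
  even among all probability measures on the line: polynomial interpolation on the support replaces
  approximation of indicator functions.
\<close>

lemma finite_support_determined_by_moments:
  fixes M N :: "real measure"
  assumes "prob_space M" "prob_space N"
    and sets: "sets M = sets borel" "sets N = sets borel"
    and momM: "\<And>k. has_bochner_integral M (\<lambda>x. x ^ k) (c k)"
    and momN: "\<And>k. has_bochner_integral N (\<lambda>x. x ^ k) (c k)"
    and T: "finite T" and AEM: "AE x in M. x \<in> T"
  shows "N = M"
proof -
  interpret M: prob_space M by fact
  interpret N: prob_space N by fact
  note [measurable_cong] = sets
  have eq: "integral\<^sup>L M (poly Q) = integral\<^sup>L N (poly Q)" for Q
    using has_bochner_integral_poly[OF momM, of Q] has_bochner_integral_poly[OF momN, of Q]
    by (simp add: has_bochner_integral_integral_eq)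
  have int: "integrable M (poly Q)" "integrable N (poly Q)" for Q
    using has_bochner_integral_poly[OF momM, of Q] has_bochner_integral_poly[OF momN, of Q]
    by (auto simp: has_bochner_integral_iff)
  \<comment> \<open>A nonnegative polynomial that vanishes exactly on \<open>T\<close>: its integral depends on the moments
    only, so it is zero for \<open>N\<close> as well, and \<open>N\<close> is concentrated on \<open>T\<close>.\<close>
  define R :: "real poly" where "R = (\<Prod>y\<in>T. [:-y, 1:])\<^sup>2"
  have R0: "poly R x = 0 \<longleftrightarrow> x \<in> T" for x
    using T by (auto simp: R_def poly_prod)
  have Rpos: "0 \<le> poly R x" for x by (simp add: R_def)
  have "integral\<^sup>L M (poly R) = integral\<^sup>L M (\<lambda>x. 0)"
    by (rule integral_cong_AE) (use AEM R0 in \<open>auto intro: borel_measurable_integrable int\<close>)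
  then have "integral\<^sup>L N (poly R) = 0" using eq by simp
  then have "AE x in N. poly R x = 0"
    using integral_nonneg_eq_0_iff_AE[OF int(2)[of R]] Rpos by auto
  then have AEN: "AE x in N. x \<in> T" using R0 by simp
  show ?thesis
  proof (rule measure_eqI)
    show "sets N = sets M" using sets by simp
    fix A assume A: "A \<in> sets N"
    \<comment> \<open>On the common support \<open>T\<close>, the indicator of \<open>A\<close> is a polynomial.\<close>
    obtain Q where Q: "\<forall>y\<in>T. poly Q y = indicator A y"
      using interpolating_polynomial[OF T, of "indicator A"] by blast
    have AM: "A \<in> sets M" using A sets by simp
    have "measure N A = integral\<^sup>L N (indicator A)" using A by simp
    also have "\<dots> = integral\<^sup>L N (poly Q)"
      by (rule integral_cong_AE)
        (use A AEN Q in \<open>auto intro: borel_measurable_integrable int elim!: eventually_mono\<close>)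
    also have "\<dots> = integral\<^sup>L M (poly Q)" by (simp add: eq)
    also have "\<dots> = integral\<^sup>L M (indicator A)"
      by (rule integral_cong_AE)
        (use AM AEM Q in \<open>auto intro: borel_measurable_integrable int elim!: eventually_mono\<close>)
    also have "\<dots> = measure M A" using AM by simp
    finally show "emeasure N A = emeasure M A"
      by (simp add: M.emeasure_eq_measure N.emeasure_eq_measure)
  qed
qed

text \<open>
  This evaluates the definite description in the definition of \<open>real_measure\<close>: to identify the real measure
  of a graph it suffices to exhibit point masses \<open>w s\<close> at \<open>g s\<close>, possibly with repetitions, whose moments
  count the loops.
\<close>

lemma real_measure_point_masses:
  fixes w g :: "'a \<Rightarrow> real"
  assumes S: "finite S" and w: "\<And>s. s \<in> S \<Longrightarrow> 0 \<le> w s" "(\<Sum>s\<in>S. w s) = 1"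
    and g: "\<And>s. s \<in> S \<Longrightarrow> 0 \<le> g s"
    and mom: "\<And>k. (\<Sum>s\<in>S. w s * g s ^ k) = real (loops X (2 * k))"
  shows "measure (real_measure X) {x} = (\<Sum>s | s \<in> S \<and> g s = x. w s)"
proof -
  define P where "P = point_measure S (\<lambda>s. ennreal (w s))"
  define M where "M = distr P borel g"
  have gP[measurable]: "g \<in> borel_measurable P"
    by (simp add: P_def point_measure_def)
  have emP: "emeasure P A = ennreal (\<Sum>s\<in>A. w s)" if "A \<subseteq> S" for A
    using that S w(1) unfolding P_def
    by (subst emeasure_point_measure_finite) (auto intro!: sum_ennreal)
  have spP: "space P = S" by (simp add: P_def space_point_measure)
  have setsM: "sets M = sets borel" by (simp add: M_def)
  have probP: "prob_space P"
    by (rule prob_spaceI) (use emP[of S] w(2) in \<open>simp add: spP\<close>)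
  then have probM: "prob_space M" unfolding M_def by (rule prob_space.prob_space_distr) simp
  have momM: "has_bochner_integral M (\<lambda>x. x ^ k) (real (loops X (2 * k)))" for k
  proof -
    have "integrable P (\<lambda>s. g s ^ k)"
      using S unfolding P_def by (intro integrable_point_measure_finite)
    moreover have "integral\<^sup>L P (\<lambda>s. g s ^ k) = real (loops X (2 * k))"
      using S w(1) mom unfolding P_def by (subst lebesgue_integral_point_measure_finite) auto
    ultimately show ?thesis
      by (simp add: has_bochner_integral_iff M_def integrable_distr_eq integral_distr)
  qed
  have AE_P: "AE s in P. s \<in> S" using AE_space[of P] by (simp add: spP)
  have AEM: "AE x in M. x \<in> g ` S" unfolding M_def
    by (subst AE_distr_iff) (use AE_P S in \<open>auto intro: finite_imp_closed borel_closed elim!: eventually_mono\<close>)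
  have AE0: "AE x in M. 0 \<le> x" using AEM by (rule eventually_mono) (use g in auto)
  have "real_measure X = M" unfolding real_measure_def
  proof (rule the_equality)
    show "prob_space M \<and> sets M = sets borel \<and> (AE x in M. 0 \<le> x) \<and>
       (\<forall>k. has_bochner_integral M (\<lambda>x. x ^ k) (real (loops X (2 * k))))"
      using probM setsM AE0 momM by blast
    show "N = M" if "prob_space N \<and> sets N = sets borel \<and> (AE x in N. 0 \<le> x) \<and>
       (\<forall>k. has_bochner_integral N (\<lambda>x. x ^ k) (real (loops X (2 * k))))" for N
      using finite_support_determined_by_moments[OF probM _ setsM _ momM _ _ AEM, of N] that S by blast
  qed
  moreover have "measure M {x} = (\<Sum>s | s \<in> S \<and> g s = x. w s)"
  proof -
    have "emeasure M {x} = emeasure P {s \<in> S. g s = x}"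
      unfolding M_def by (subst emeasure_distr) (auto simp: spP intro!: arg_cong[of _ _ "emeasure P"])
    also have "\<dots> = ennreal (\<Sum>s | s \<in> S \<and> g s = x. w s)" by (rule emP) auto
    finally have "emeasure M {x} = ennreal (\<Sum>s | s \<in> S \<and> g s = x. w s)" .
    moreover have "0 \<le> (\<Sum>s | s \<in> S \<and> g s = x. w s)" using w(1) by (intro sum_nonneg) auto
    ultimately show ?thesis by (simp add: measure_def)
  qed
  ultimately show ?thesis by simp
qed

section \<open>Circular measures from moments\<close>

text \<open>
  The first condition says that \<open>m\<close> is the sum of point masses at \<open>2 N\<close>-th roots of unity, so that its values
  on singletons determine it. The symmetries are those of the fibres of \<open>q \<mapsto> (q + 1/q)\<^sup>2\<close>.
\<close>

definition symmetric_on_roots :: "nat \<Rightarrow> (complex set \<Rightarrow> real) \<Rightarrow> bool" where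
  "symmetric_on_roots N m \<longleftrightarrow> (\<forall>B. m B = (\<Sum>q | q ^ (2 * N) = 1 \<and> q \<in> B. m {q})) \<and>
     (\<forall>q. m {- q} = m {q} \<and> m {inverse q} = m {q})"

lemma finite_even_roots: "0 < N \<Longrightarrow> finite {q::complex. q ^ (2 * N) = 1}"
  by (rule finite_roots_unity) simp

lemma root_of_unity_unit:
  fixes q :: complex
  assumes "0 < N" "q ^ (2 * N) = 1"
  shows "q \<noteq> 0" "inverse q = cnj q" "q + inverse q = of_real (2 * Re q)"
proof -
  have "norm q ^ (2 * N) = 1" using assms(2) by (metis norm_one norm_power)
  then have n: "norm q = 1" using assms(1) power_eq_imp_eq_base[of "norm q" "2 * N" 1] by simp
  then show "q \<noteq> 0" by auto
  have "q * cnj q = 1" using n by (simp flip: complex_norm_square)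
  then show i: "inverse q = cnj q" by (rule inverse_unique)
  show "q + inverse q = of_real (2 * Re q)" unfolding i by (simp add: complex_add_cnj)
qed

lemma sum_even_roots_uminus:
  "(\<Sum>q::complex | q ^ (2 * N) = 1. f (- q)) = (\<Sum>q | q ^ (2 * N) = 1. f q)"
  by (rule sum.reindex_bij_witness[of _ uminus uminus]) auto

lemma sum_even_roots_inverse:
  "(\<Sum>q::complex | q ^ (2 * N) = 1. f (inverse q)) = (\<Sum>q | q ^ (2 * N) = 1. f q)"
  by (rule sum.reindex_bij_witness[of _ inverse inverse]) (auto simp: power_inverse)

text \<open>
  The difference of the two squares factors into the four linear conditions, up to the unit \<open>(r q)\<^sup>2\<close>.
\<close>

lemma same_square_of_sum_with_inverse:
  fixes q r :: complex
  assumes "q \<noteq> 0" "r \<noteq> 0" "(r + inverse r)\<^sup>2 = (q + inverse q)\<^sup>2"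
  shows "r = q \<or> r = inverse q \<or> r = - q \<or> r = - inverse q"
proof -
  have "(r - q) * (r * q - 1) * (r + q) * (r * q + 1) = (r * q)\<^sup>2 * ((r + inverse r)\<^sup>2 - (q + inverse q)\<^sup>2)"
    using assms(1,2) by (simp add: field_simps power2_eq_square)
  also have "\<dots> = 0" using assms(3) by simp
  finally have "r = q \<or> r * q = 1 \<or> r = - q \<or> r * q = - 1"
    by (simp add: eq_neg_iff_add_eq_0 disj_ac)
  then show ?thesis using assms(1) by (auto simp: field_simps)
qed

text \<open>
  Pushing \<open>m\<close> forward along \<open>q \<mapsto> (q + 1/q)\<^sup>2\<close>, which is \<open>(2 Re q)\<^sup>2\<close> on the circle, gives the real measure.
  The circular measure spreads the mass of each fibre evenly over \<open>q, 1/q, -q, -1/q\<close>, and that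
  recovers \<open>m\<close>, because \<open>m\<close> is constant on fibres. Averaging over the fibre of every point of the support,
  instead of summing over the fibres, treats fibres with repetitions in the same way as the others.
\<close>

lemma circular_measure_eq_of_moments:
  assumes N: "0 < N" and m: "symmetric_on_roots N m"
    and nonneg: "\<And>q. q ^ (2 * N) = 1 \<Longrightarrow> 0 \<le> m {q}"
    and total: "(\<Sum>q | q ^ (2 * N) = 1. m {q}) = 1"
    and mom: "\<And>k. (\<Sum>q | q ^ (2 * N) = 1. m {q} * (2 * Re q) ^ (2 * k)) = real (loops X (2 * k))"
  shows "circular_measure X = m"
proof
  fix B
  define S :: "complex set" where "S = {q. q ^ (2 * N) = 1}"
  have S: "finite S" using finite_even_roots[OF N] by (simp add: S_def)
  define g :: "complex \<Rightarrow> real" where "g q = (2 * Re q)\<^sup>2" for q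
  define p where "p x = measure (real_measure X) {x}" for x
  define F where "F q = dirac q B + dirac (inverse q) B + dirac (- q) B + dirac (- inverse q) B" for q
  have sym: "m {- q} = m {q}" "m {inverse q} = m {q}" for q
    using m unfolding symmetric_on_roots_def by blast+
  have p: "p x = (\<Sum>q | q \<in> S \<and> g q = x. m {q})" for x
    unfolding p_def
    by (rule real_measure_point_masses)
      (use S nonneg total mom in \<open>auto simp: S_def g_def power_mult\<close>)
  \<comment> \<open>The root chosen by \<open>q_of\<close> lies in the fibre of \<open>q\<close>, and \<open>F\<close> is constant on fibres.\<close>
  have FF: "F (q_of (g q)) = F q" if "q \<in> S" for q
  proof -
    have q: "q \<noteq> 0" "q + inverse q = of_real (2 * Re q)"
      using root_of_unity_unit[OF N] that by (auto simp: S_def)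
    have "q \<noteq> 0 \<and> (q + inverse q)\<^sup>2 = complex_of_real (g q)"
      unfolding g_def q(2) using q(1) by simp
    then have "q_of (g q) \<noteq> 0 \<and> (q_of (g q) + inverse (q_of (g q)))\<^sup>2 = complex_of_real (g q)"
      unfolding q_of_def by (rule someI)
    then have "q_of (g q) \<noteq> 0" "(q_of (g q) + inverse (q_of (g q)))\<^sup>2 = (q + inverse q)\<^sup>2"
      unfolding g_def q(2) by simp_all
    from same_square_of_sum_with_inverse[OF q(1) this] show ?thesis
      by (auto simp: F_def)
  qed
  have "4 * circular_measure X B = (\<Sum>x | p x \<noteq> 0. p x * F (q_of x))"
    by (simp add: circular_measure_def p_def F_def)
  also have "\<dots> = (\<Sum>x\<in>g ` S. p x * F (q_of x))"
  proof (rule sum.mono_neutral_left)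
    show "{x. p x \<noteq> 0} \<subseteq> g ` S"
    proof
      fix x assume "x \<in> {x. p x \<noteq> 0}"
      then have "(\<Sum>q | q \<in> S \<and> g q = x. m {q}) \<noteq> 0" by (simp only: p mem_Collect_eq not_False_eq_True)
      then obtain q where "q \<in> {q. q \<in> S \<and> g q = x}"
        by (rule sum.not_neutral_contains_not_neutral)
      then show "x \<in> g ` S" by auto
    qed
  qed (use S in auto)
  also have "\<dots> = (\<Sum>x\<in>g ` S. \<Sum>q | q \<in> S \<and> g q = x. m {q} * F q)"
    unfolding p sum_distrib_right by (intro sum.cong refl) (metis (mono_tags, lifting) FF mem_Collect_eq)
  also have "\<dots> = (\<Sum>q\<in>S. m {q} * F q)"
    by (rule sum.group) (use S in auto)
  also have "\<dots> = (\<Sum>q\<in>S. m {q} * dirac q B) + (\<Sum>q\<in>S. m {inverse q} * dirac (inverse q) B)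
      + (\<Sum>q\<in>S. m {- q} * dirac (- q) B) + (\<Sum>q\<in>S. m {- inverse q} * dirac (- inverse q) B)"
    by (simp add: F_def distrib_left sum.distrib sym)
  also have "\<dots> = 4 * (\<Sum>q\<in>S. m {q} * dirac q B)"
    unfolding S_def sum_even_roots_inverse[of "\<lambda>q. m {- q} * dirac (- q) B"]
      sum_even_roots_inverse[of "\<lambda>q. m {q} * dirac q B"]
      sum_even_roots_uminus[of "\<lambda>q. m {q} * dirac q B"] by simp
  also have "(\<Sum>q\<in>S. m {q} * dirac q B) = (\<Sum>q | q ^ (2 * N) = 1 \<and> q \<in> B. m {q})"
    by (rule sum.mono_neutral_cong_right) (use S in \<open>auto simp: S_def dirac_def indicator_def\<close>)
  also have "\<dots> = m B" using m unfolding symmetric_on_roots_def by (metis (lifting))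
  finally show "circular_measure X B = m B" by simp
qed

section \<open>Loops and eigenfunctions\<close>

text \<open>
  The loop count with a variable end vertex, which allows recursion on the length.
\<close>

definition walks :: "'v rooted_graph \<Rightarrow> nat \<Rightarrow> 'v \<Rightarrow> nat" where
  "walks X m v =
    (\<Sum>vs | length vs = Suc m \<and> set vs \<subseteq> verts X \<and> hd vs = root X \<and> last vs = v.
       \<Prod>i<m. count (edges X) {vs ! i, vs ! Suc i})"

lemma walks_0:
  assumes "root X \<in> verts X"
  shows "walks X 0 v = (if v = root X then 1 else 0)"
proof -
  have "{vs. length vs = Suc 0 \<and> set vs \<subseteq> verts X \<and> hd vs = root X \<and> last vs = v} =
      (if v = root X then {[root X]} else {})"
    using assms by (auto simp: length_Suc_conv)
  then show ?thesis by (simp add: walks_def)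
qed

lemma walks_Suc:
  assumes "finite (verts X)" "v \<in> verts X"
  shows "walks X (Suc m) v = (\<Sum>u\<in>verts X. walks X m u * count (edges X) {u, v})"
proof -
  define W where "W = {vs. length vs = Suc m \<and> set vs \<subseteq> verts X \<and> hd vs = root X}"
  define h where "h vs = (\<Prod>i<m. count (edges X) {vs ! i, vs ! Suc i})" for vs
  have W: "finite W"
    by (rule finite_subset[OF _ finite_lists_length_eq[OF assms(1), of "Suc m"]])
      (auto simp: W_def)
  have last_in: "last vs \<in> verts X" if "vs \<in> W" for vs
    using that last_in_set[of vs] by (cases vs) (auto simp: W_def)
  have "walks X (Suc m) v = (\<Sum>vs\<in>W. h vs * count (edges X) {last vs, v})"
    unfolding walks_def
  proof (rule sum.reindex_bij_witness[of _ "\<lambda>vs. vs @ [v]" butlast], goal_cases)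
    case (1 a) then show ?case by (cases a rule: rev_cases) auto
  next
    case (2 a) then show ?case
      by (cases a rule: rev_cases) (auto simp: W_def hd_append split: if_splits)
  next
    case (3 b) then show ?case by simp
  next
    case (4 b) then show ?case using assms(2) by (auto simp: W_def hd_append)
  next
    case (5 a)
    then obtain vs where a: "a = vs @ [v]" and vs: "length vs = Suc m"
      by (cases a rule: rev_cases) auto
    have "last vs = vs ! m" using vs by (cases vs rule: rev_cases) (auto simp: nth_append)
    then show ?case using vs by (simp add: a h_def nth_append)
  qed
  also have "\<dots> = (\<Sum>u\<in>verts X. \<Sum>vs | vs \<in> W \<and> last vs = u. h vs * count (edges X) {last vs, v})"
    by (rule sum.group[symmetric]) (use W assms(1) last_in in auto)
  also have "\<dots> = (\<Sum>u\<in>verts X. walks X m u * count (edges X) {u, v})"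
    unfolding walks_def sum_distrib_right W_def h_def
    by (intro sum.cong refl) auto
  finally show ?thesis .
qed

text \<open>
  The powers of the adjacency matrix count walks, and they act on an eigenfunction through powers of its
  eigenvalue.
\<close>

lemma power_eigenfunction_eq_sum_walks:
  fixes F :: "'v \<Rightarrow> complex"
  assumes "finite (verts X)" "root X \<in> verts X"
    and eig: "\<And>v. v \<in> verts X \<Longrightarrow> x * F v = (\<Sum>u\<in>verts X. of_nat (count (edges X) {u, v}) * F u)"
  shows "x ^ m * F (root X) = (\<Sum>v\<in>verts X. of_nat (walks X m v) * F v)"
proof (induction m)
  case 0
  have "(\<Sum>v\<in>verts X. of_nat (walks X 0 v) * F v) = (\<Sum>v\<in>verts X. if v = root X then F v else 0)"
    using assms(2) by (intro sum.cong) (auto simp: walks_0)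
  then show ?case using assms(1,2) by simp
next
  case (Suc m)
  have "x ^ Suc m * F (root X) = x * (\<Sum>v\<in>verts X. of_nat (walks X m v) * F v)"
    unfolding Suc.IH[symmetric] by (simp only: power_Suc mult.assoc)
  also have "\<dots> = (\<Sum>v\<in>verts X. of_nat (walks X m v) * (x * F v))"
    by (simp only: sum_distrib_left mult.left_commute)
  also have "\<dots> = (\<Sum>v\<in>verts X. \<Sum>u\<in>verts X. of_nat (walks X m v * count (edges X) {v, u}) * F u)"
  proof (rule sum.cong[OF refl])
    fix v assume v: "v \<in> verts X"
    show "of_nat (walks X m v) * (x * F v) =
        (\<Sum>u\<in>verts X. of_nat (walks X m v * count (edges X) {v, u}) * F u)"
      unfolding eig[OF v] sum_distrib_left
      by (intro sum.cong refl) (simp add: insert_commute mult.assoc)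
  qed
  also have "\<dots> = (\<Sum>u\<in>verts X. \<Sum>v\<in>verts X. of_nat (walks X m v * count (edges X) {v, u}) * F u)"
    by (rule sum.swap)
  also have "\<dots> = (\<Sum>u\<in>verts X. of_nat (walks X (Suc m) u) * F u)"
    using assms(1) by (intro sum.cong) (simp_all add: walks_Suc sum_distrib_right)
  finally show ?case .
qed

text \<open>
  The spectral theorem in reverse. If \<open>F\<close> were the family of projections of the unit vector at the root to the
  eigenspaces, the hypotheses would be the eigenvalue equation and the decomposition of that unit vector.
  Conversely, summing \<open>(q + 1/q)\<^sup>k * F (root) q\<close> over all \<open>q\<close>, and expanding it with the eigenvalue equation
  into walks, leaves only the walks that end at the root.

  One eigenvalue may belong to several \<open>q\<close>, and \<open>F\<close> is scaled by the mass \<open>m {q}\<close> instead of being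
  normalised. So points of mass zero are harmless, and \<open>F\<close> may be a sum of families that belong to
  different parts of \<open>m\<close>.
\<close>

lemma circular_measure_eqI:
  fixes F :: "'v \<Rightarrow> complex \<Rightarrow> complex"
  assumes N: "0 < N" and m: "symmetric_on_roots N m"
    and nonneg: "\<And>q. q ^ (2 * N) = 1 \<Longrightarrow> 0 \<le> m {q}"
    and V: "finite (verts X)" "root X \<in> verts X"
    and root: "\<And>q. q ^ (2 * N) = 1 \<Longrightarrow> F (root X) q = of_real (m {q})"
    and eig: "\<And>q v. q ^ (2 * N) = 1 \<Longrightarrow> v \<in> verts X \<Longrightarrow>
      (q + inverse q) * F v q = (\<Sum>u\<in>verts X. of_nat (count (edges X) {u, v}) * F u q)"
    and orth: "\<And>v. v \<in> verts X \<Longrightarrow> (\<Sum>q | q ^ (2 * N) = 1. F v q) = (if v = root X then 1 else 0)"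
  shows "circular_measure X = m"
proof (rule circular_measure_eq_of_moments[OF N m nonneg])
  have mom: "(\<Sum>q | q ^ (2 * N) = 1. m {q} * (2 * Re q) ^ k) = real (loops X k)" for k
  proof -
    have "complex_of_real (\<Sum>q | q ^ (2 * N) = 1. m {q} * (2 * Re q) ^ k) =
        (\<Sum>q | q ^ (2 * N) = 1. (q + inverse q) ^ k * F (root X) q)"
      using root root_of_unity_unit(3)[OF N] by (auto intro!: sum.cong)
    also have "\<dots> = (\<Sum>q | q ^ (2 * N) = 1. \<Sum>v\<in>verts X. of_nat (walks X k v) * F v q)"
      by (intro sum.cong power_eigenfunction_eq_sum_walks V eig) auto
    also have "\<dots> = (\<Sum>v\<in>verts X. of_nat (walks X k v) * (\<Sum>q | q ^ (2 * N) = 1. F v q))"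
      by (subst sum.swap) (simp add: sum_distrib_left)
    also have "\<dots> = (\<Sum>v\<in>verts X. if v = root X then of_nat (walks X k v) else 0)"
      by (intro sum.cong) (auto simp: orth)
    also have "\<dots> = of_nat (walks X k (root X))" using V by simp
    also have "walks X k (root X) = loops X k" by (simp add: walks_def loops_def)
    finally show ?thesis by (metis of_real_eq_iff of_real_of_nat_eq)
  qed
  show "(\<Sum>q | q ^ (2 * N) = 1. m {q} * (2 * Re q) ^ (2 * k)) = real (loops X (2 * k))" for k
    by (rule mom)
  have "real (loops X 0) = 1"
    using walks_0[of X "root X"] V by (simp add: walks_def loops_def)
  then show "(\<Sum>q | q ^ (2 * N) = 1. m {q}) = 1" using mom[of 0] by simp
qed

section \<open>Cosine sums over roots of unity\<close>

lemma sum_powers_roots_of_unity: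
  assumes "0 < M"
  shows "(\<Sum>q::complex | q ^ M = 1. q ^ k) = (if M dvd k then of_nat M else 0)"
proof (cases "M dvd k")
  case True
  then obtain j where k: "k = M * j" by blast
  have "(\<Sum>q::complex | q ^ M = 1. q ^ k) = (\<Sum>q::complex | q ^ M = 1. 1)"
    by (intro sum.cong) (auto simp: k power_mult)
  then show ?thesis using True assms by (simp add: card_roots_unity_eq)
next
  case False
  \<comment> \<open>Some \<open>M\<close>-th root of unity \<open>w\<close> has \<open>w ^ k \<noteq> 1\<close>, for otherwise all \<open>M\<close> of them would be roots of
    \<open>z ^ r - 1\<close> with \<open>r < M\<close>. Multiplication by \<open>w\<close> permutes the roots and scales the sum by \<open>w ^ k\<close>.\<close>
  define r where "r = k mod M"
  have r: "0 < r" "r < M" using False assms by (auto simp: r_def mod_greater_zero_iff_not_dvd)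
  have red: "z ^ k = z ^ r" if "z ^ M = 1" for z :: complex
  proof -
    have "z ^ k = z ^ (M * (k div M) + r)" by (simp add: r_def)
    then show ?thesis using that by (simp only: power_add power_mult) simp
  qed
  have "\<not> {z::complex. z ^ M = 1} \<subseteq> {z. z ^ r = 1}"
  proof
    assume "{z::complex. z ^ M = 1} \<subseteq> {z. z ^ r = 1}"
    then have "card {z::complex. z ^ M = 1} \<le> card {z::complex. z ^ r = 1}"
      using r by (intro card_mono finite_roots_unity) auto
    then show False using r assms by (simp add: card_roots_unity_eq)
  qed
  then obtain w :: complex where w: "w ^ M = 1" "w ^ k \<noteq> 1" using red by auto
  then have w0: "w \<noteq> 0" using assms by (auto simp: power_0_left)
  have "(\<Sum>q::complex | q ^ M = 1. q ^ k) = (\<Sum>q::complex | q ^ M = 1. (w * q) ^ k)"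
    by (rule sum.reindex_bij_witness[of _ "\<lambda>q. w * q" "\<lambda>q. q / w"])
      (use w w0 in \<open>auto simp: power_mult_distrib power_divide\<close>)
  also have "\<dots> = w ^ k * (\<Sum>q::complex | q ^ M = 1. q ^ k)"
    by (simp add: power_mult_distrib sum_distrib_left)
  finally show ?thesis using w(2) False by simp
qed

text \<open>
  On the unit circle this is the cosine of \<open>k\<close> times the argument of \<open>q\<close>.
\<close>

definition cosine :: "nat \<Rightarrow> complex \<Rightarrow> complex" where
  "cosine k q = (q ^ k + inverse q ^ k) / 2"

lemma cosine_0 [simp]: "cosine 0 q = 1" by (simp add: cosine_def)

text \<open>
  The index \<open>(i - j) + (j - i)\<close> is the distance of the natural numbers \<open>i\<close> and \<open>j\<close>, as one of the two truncated
  differences is zero.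
\<close>

lemma cosine_mult:
  assumes "q \<noteq> 0"
  shows "cosine i q * cosine j q = (cosine (i + j) q + cosine ((i - j) + (j - i)) q) / 2"
proof -
  have *: "cosine i q * cosine j q = (cosine (i + j) q + cosine (i - j) q) / 2" if "j \<le> i" for i j
  proof -
    obtain e where "i = j + e" using \<open>j \<le> i\<close> le_Suc_ex by blast
    then show ?thesis using assms by (simp add: cosine_def power_add field_simps)
  qed
  show ?thesis
    using *[of i j] *[of j i] by (cases "j \<le> i") (auto simp: mult.commute add.commute)
qed

text \<open>
  Multiplication by the eigenvalue \<open>q + 1/q\<close> acts on the cosines as the adjacency operator of a path.
\<close>

lemma cosine_step:
  assumes "q \<noteq> 0"
  shows "(q + inverse q) * cosine (Suc k) q = cosine (Suc (Suc k)) q + cosine k q"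
  using assms by (simp add: cosine_def field_simps)

lemma d_singleton:
  assumes "0 < n"
  shows "d n {q} = (if q ^ (2 * n) = 1 then 1 / (2 * real n) else 0)"
proof -
  have "finite {z::complex. z ^ (2 * n) = 1}" "{z::complex. z ^ (2 * n) = 1} \<noteq> {}"
    using assms finite_even_roots by (auto intro: exI[of _ 1])
  then have "d n {q} = indicator {z::complex. z ^ (2 * n) = 1} q / card {z::complex. z ^ (2 * n) = 1}"
    by (simp add: d_def measure_pmf_single)
  then show ?thesis using assms by (simp add: card_roots_unity_eq)
qed

text \<open>
  Removing the roots of \<open>z - 1\<close> from those of \<open>z\<^sup>2 - 1\<close>, where \<open>z = q ^ (2 * n)\<close>, leaves \<open>z = -1\<close>. In the same way
  the next two lemmas use the quadratic factors of \<open>z\<^sup>3 + 1\<close> and \<open>z\<^sup>3 - 1\<close>.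
\<close>

lemma d'_singleton:
  assumes "0 < n"
  shows "d' n {q} = (if q ^ (2 * n) = - 1 then 1 / (2 * real n) else 0)"
proof -
  have "q ^ (2 * (2 * n)) = 1 \<longleftrightarrow> q ^ (2 * n) = 1 \<or> q ^ (2 * n) = - 1"
    using power2_eq_1_iff[of "q ^ (2 * n)"] by (simp add: mult.commute flip: power_mult)
  then show ?thesis using assms by (auto simp: d'_def d_singleton)
qed

lemma d''_singleton:
  assumes "0 < n"
  shows "d'' n {q} = (if q ^ (4 * n) - q ^ (2 * n) + 1 = 0 then 1 / (4 * real n) else 0)"
proof -
  define z where "z = q ^ (2 * n)"
  have e: "q ^ (6 * n) = z ^ 3" "q ^ (4 * n) = z ^ 2"
    by (simp_all add: z_def mult.commute flip: power_mult)
  have "z ^ 3 + 1 = (z + 1) * (z ^ 2 - z + 1)" by algebra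
  then have "z ^ 3 = - 1 \<longleftrightarrow> z = - 1 \<or> z ^ 2 - z + 1 = 0"
    by (metis add_eq_0_iff2 mult_eq_0_iff)
  then show ?thesis using assms
    by (auto simp: d''_def d'_singleton e z_def[symmetric])
qed

lemma d'''_singleton:
  assumes "0 < n"
  shows "d''' n {q} = (if q ^ (4 * n) + q ^ (2 * n) + 1 = 0 then 1 / (4 * real n) else 0)"
proof -
  define z where "z = q ^ (2 * n)"
  have e: "q ^ (6 * n) = z ^ 3" "q ^ (4 * n) = z ^ 2"
    by (simp_all add: z_def mult.commute flip: power_mult)
  have "z ^ 3 - 1 = (z - 1) * (z ^ 2 + z + 1)" by algebra
  then have "z ^ 3 = 1 \<longleftrightarrow> z = 1 \<or> z ^ 2 + z + 1 = 0"
    by (metis eq_iff_diff_eq_0 mult_eq_0_iff)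
  then show ?thesis using assms
    by (auto simp: d'''_def d_singleton e z_def[symmetric])
qed

lemma weighted_singleton: "weighted f m {q} = f q * m {q}"
proof -
  have "{p. p \<in> {q} \<and> m {p} \<noteq> 0} = (if m {q} = 0 then {} else {q})" by auto
  then show ?thesis by (simp add: weighted_def)
qed

lemma symmetric_on_roots_d:
  assumes "0 < N" "n dvd N"
  shows "symmetric_on_roots N (d n)"
proof -
  have n: "0 < n" using assms by (auto intro: gr0I)
  have fin: "finite {z::complex. z ^ (2 * n) = 1}" "{z::complex. z ^ (2 * n) = 1} \<noteq> {}"
    using n finite_even_roots by (auto intro: exI[of _ 1])
  have sub: "q ^ (2 * N) = 1" if "q ^ (2 * n) = 1" for q :: complex
    using that assms(2) by (auto simp: power_mult mult.assoc[symmetric])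
  have "d n B = (\<Sum>q | q ^ (2 * N) = 1 \<and> q \<in> B. d n {q})" for B
  proof -
    have "d n B = card ({z::complex. z ^ (2 * n) = 1} \<inter> B) / card {z::complex. z ^ (2 * n) = 1}"
      unfolding d_def by (rule measure_pmf_of_set[OF fin(2,1)])
    also have "\<dots> = (\<Sum>q\<in>{z::complex. z ^ (2 * n) = 1} \<inter> B. 1 / (2 * real n))"
      using n by (simp add: card_roots_unity_eq)
    also have "\<dots> = (\<Sum>q | q ^ (2 * N) = 1 \<and> q \<in> B. d n {q})"
      by (rule sum.mono_neutral_cong_left)
        (use finite_even_roots[OF assms(1)] sub n in \<open>auto simp: d_singleton\<close>)
    finally show ?thesis .
  qed
  moreover have "d n {- q} = d n {q}" "d n {inverse q} = d n {q}" for q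
    using n by (simp_all add: d_singleton power_inverse)
  ultimately show ?thesis unfolding symmetric_on_roots_def by blast
qed

lemma symmetric_on_rootsD:
  assumes "symmetric_on_roots N m"
  shows "m B = (\<Sum>q | q ^ (2 * N) = 1 \<and> q \<in> B. m {q})"
    and "m {- q} = m {q}" and "m {inverse q} = m {q}"
  using assms unfolding symmetric_on_roots_def by blast+

lemma symmetric_on_roots_add:
  assumes "symmetric_on_roots N m" "symmetric_on_roots N m'"
  shows "symmetric_on_roots N (\<lambda>B. m B + m' B)"
  unfolding symmetric_on_roots_def sum.distrib
  by (intro allI conjI arg_cong2[where f = "(+)"]
      symmetric_on_rootsD[OF assms(1)] symmetric_on_rootsD[OF assms(2)])

lemma symmetric_on_roots_diff:
  assumes "symmetric_on_roots N m" "symmetric_on_roots N m'"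
  shows "symmetric_on_roots N (\<lambda>B. m B - m' B)"
  unfolding symmetric_on_roots_def sum_subtractf
  by (intro allI conjI arg_cong2[where f = "(-)"]
      symmetric_on_rootsD[OF assms(1)] symmetric_on_rootsD[OF assms(2)])

lemma symmetric_on_roots_mult:
  assumes "symmetric_on_roots N m"
  shows "symmetric_on_roots N (\<lambda>B. c * m B)"
  unfolding symmetric_on_roots_def sum_distrib_left[symmetric]
  by (intro allI conjI arg_cong2[where f = "(*)"] refl symmetric_on_rootsD[OF assms])

lemma symmetric_on_roots_divide:
  assumes "symmetric_on_roots N m"
  shows "symmetric_on_roots N (\<lambda>B. m B / c)"
  unfolding symmetric_on_roots_def sum_divide_distrib[symmetric]
  by (intro allI conjI arg_cong2[where f = "(/)"] refl symmetric_on_rootsD[OF assms])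

lemma symmetric_on_roots_weighted:
  assumes N: "0 < N" and m: "symmetric_on_roots N m"
    and f: "\<And>q. q ^ (2 * N) = 1 \<Longrightarrow> f (- q) = f q \<and> f (inverse q) = f q"
  shows "symmetric_on_roots N (weighted f m)"
proof -
  note sym = symmetric_on_rootsD(2,3)[OF m]
  have supp: "q ^ (2 * N) = 1" if "m {q} \<noteq> 0" for q
  proof (rule ccontr)
    assume "q ^ (2 * N) \<noteq> 1"
    then have empty: "{p. p ^ (2 * N) = 1 \<and> p \<in> {q}} = {}" by auto
    have "m {q} = (\<Sum>p | p ^ (2 * N) = 1 \<and> p \<in> {q}. m {p})"
      by (rule symmetric_on_rootsD(1)[OF m])
    also have "\<dots> = 0" unfolding empty by simp
    finally show False using that by simp
  qed
  have "weighted f m B = (\<Sum>q | q ^ (2 * N) = 1 \<and> q \<in> B. weighted f m {q})" for B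
    unfolding weighted_singleton unfolding weighted_def
  proof (rule sum.mono_neutral_left)
    show "finite {q. q ^ (2 * N) = 1 \<and> q \<in> B}" using finite_even_roots[OF N] by simp
    show "{q. q \<in> B \<and> m {q} \<noteq> 0} \<subseteq> {q. q ^ (2 * N) = 1 \<and> q \<in> B}" using supp by blast
  qed auto
  moreover have "f (- q) * m {q} = f q * m {q}" "f (inverse q) * m {q} = f q * m {q}" for q
    using f supp by (cases "m {q} = 0"; simp)+
  ultimately show ?thesis
    unfolding symmetric_on_roots_def weighted_singleton sym by blast
qed

text \<open>
  The densities of the statement are one minus a cosine, so that integrals of cosines against weighted measures
  reduce to unweighted ones by the product formula.
\<close>

lemma of_real_density:
  assumes "0 < N" "q ^ (2 * N) = 1"
  shows "complex_of_real (Re (1 - q ^ j)) = 1 - cosine j q"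
proof -
  have "inverse q ^ j = cnj (q ^ j)" using root_of_unity_unit(2)[OF assms] by simp
  then show ?thesis using complex_add_cnj[of "q ^ j"] by (simp add: cosine_def)
qed

lemma symmetric_on_roots_weighted_density:
  assumes "0 < N" "symmetric_on_roots N m" "even j"
  shows "symmetric_on_roots N (weighted (\<lambda>q. Re (1 - q ^ j)) m)"
  by (rule symmetric_on_roots_weighted[OF assms(1,2)])
    (use assms(3) root_of_unity_unit(2)[OF assms(1)] in \<open>simp flip: complex_cnj_power\<close>)

lemma symmetric_on_roots_d':
  assumes "0 < N" "2 * n dvd N"
  shows "symmetric_on_roots N (d' n)"
proof -
  have "n dvd N" using assms(2) dvd_mult_right by blast
  then show ?thesis unfolding d'_def using assms
    by (intro symmetric_on_roots_diff symmetric_on_roots_mult symmetric_on_roots_d)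
qed

lemmas symmetric_on_roots_intros = symmetric_on_roots_add symmetric_on_roots_diff
  symmetric_on_roots_mult symmetric_on_roots_divide symmetric_on_roots_weighted_density
  symmetric_on_roots_d

text \<open>
  The integral of \<open>f\<close> with respect to a measure on the \<open>2 N\<close>-th roots of unity.
\<close>

definition pairing :: "nat \<Rightarrow> (complex set \<Rightarrow> real) \<Rightarrow> (complex \<Rightarrow> complex) \<Rightarrow> complex" where
  "pairing N m f = (\<Sum>q | q ^ (2 * N) = 1. of_real (m {q}) * f q)"

lemma pairing_measure_linear:
  "pairing N (\<lambda>B. m B + m' B) f = pairing N m f + pairing N m' f"
  "pairing N (\<lambda>B. m B - m' B) f = pairing N m f - pairing N m' f"
  "pairing N (\<lambda>B. a * m B) f = of_real a * pairing N m f"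
  "pairing N (\<lambda>B. m B / a) f = pairing N m f / of_real a"
  by (simp_all add: pairing_def ring_distribs sum.distrib sum_subtractf sum_distrib_left
      sum_divide_distrib mult.assoc)

lemma pairing_function_linear:
  "pairing N m (\<lambda>q. f q + g q) = pairing N m f + pairing N m g"
  "pairing N m (\<lambda>q. f q - g q) = pairing N m f - pairing N m g"
  "pairing N m (\<lambda>q. c * f q) = c * pairing N m f"
  by (simp_all add: pairing_def ring_distribs sum.distrib sum_subtractf sum_distrib_left mult_ac)

lemma pairing_weighted_cosine:
  assumes "0 < N"
  shows "pairing N (weighted (\<lambda>q. Re (1 - q ^ j)) m) (cosine k) =
    pairing N m (cosine k) - (pairing N m (cosine (j + k)) + pairing N m (cosine ((j - k) + (k - j)))) / 2"
proof -
  have "pairing N (weighted (\<lambda>q. Re (1 - q ^ j)) m) (cosine k) =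
      pairing N m (\<lambda>q. cosine k q - (1 / 2) * (cosine (j + k) q + cosine ((j - k) + (k - j)) q))"
    unfolding pairing_def weighted_singleton
  proof (intro sum.cong refl)
    fix q :: complex assume "q \<in> {q. q ^ (2 * N) = 1}"
    then have q: "q ^ (2 * N) = 1" by simp
    show "complex_of_real (Re (1 - q ^ j) * m {q}) * cosine k q =
        of_real (m {q}) * (cosine k q - (1 / 2) * (cosine (j + k) q + cosine ((j - k) + (k - j)) q))"
    proof -
      have *: "(1 - cosine j q) * cosine k q =
          cosine k q - (1 / 2) * (cosine (j + k) q + cosine ((j - k) + (k - j)) q)"
        using cosine_mult[OF root_of_unity_unit(1)[OF assms q], of j k] by (simp add: left_diff_distrib)
      show ?thesis
        unfolding of_real_mult of_real_density[OF assms q] *[symmetric] by (simp only: mult_ac)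
    qed
  qed
  then show ?thesis by (simp only: pairing_function_linear) simp
qed

lemma pairing_d_power:
  assumes "0 < N" "n dvd N"
  shows "pairing N (d n) (\<lambda>q. q ^ k) = (if 2 * n dvd k then 1 else 0)"
proof -
  have n: "0 < n" using assms by (auto intro: gr0I)
  have sub: "q ^ (2 * N) = 1" if "q ^ (2 * n) = 1" for q :: complex
    using that assms(2) by (auto simp: power_mult mult.assoc[symmetric])
  have "pairing N (d n) (\<lambda>q. q ^ k) = (\<Sum>q::complex | q ^ (2 * n) = 1. q ^ k / of_nat (2 * n))"
    unfolding pairing_def
    by (rule sum.mono_neutral_cong_right)
      (use finite_even_roots[OF assms(1)] sub n in \<open>auto simp: d_singleton\<close>)
  also have "\<dots> = (\<Sum>q::complex | q ^ (2 * n) = 1. q ^ k) / of_nat (2 * n)"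
    by (simp only: sum_divide_distrib)
  also have "\<dots> = (if 2 * n dvd k then 1 else 0)"
    using n by (subst sum_powers_roots_of_unity) auto
  finally show ?thesis .
qed

lemma pairing_inverse:
  assumes "symmetric_on_roots N m"
  shows "pairing N m (\<lambda>q. f (inverse q)) = pairing N m f"
proof -
  show ?thesis
    using symmetric_on_rootsD(3)[OF assms] sum_even_roots_inverse[of "\<lambda>q. of_real (m {q}) * f q" N] by (simp add: pairing_def)
qed

text \<open>
  The \<open>2 n\<close>-th roots of unity see only the frequencies that are multiples of \<open>2 n\<close>. The orthogonality
  relations for all graphs but the cycles come from this; for the cycles the same holds with powers of \<open>q\<close>.
\<close>

lemma pairing_d:
  assumes "0 < N" "n dvd N"
  shows "pairing N (d n) (cosine k) = (if 2 * n dvd k then 1 else 0)"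
proof -
  have "cosine k = (\<lambda>q. (1 / 2) * (q ^ k + inverse q ^ k))" by (simp add: cosine_def fun_eq_iff)
  then show ?thesis
    using pairing_inverse[OF symmetric_on_roots_d[OF assms], of "\<lambda>q. q ^ k"] pairing_d_power[OF assms]
    by (simp only: pairing_function_linear) simp
qed

lemma pairing_d':
  assumes "0 < N" "2 * n dvd N"
  shows "pairing N (d' n) (cosine k) = 2 * (if 4 * n dvd k then 1 else 0) - (if 2 * n dvd k then 1 else 0)"
proof -
  have "n dvd N" using assms(2) dvd_mult_right by blast
  then show ?thesis
    unfolding d'_def pairing_measure_linear using assms by (simp add: pairing_d mult.assoc[symmetric])
qed

text \<open>
  In a bipartite graph, eigenfunctions at vertices of odd distance from the root are odd in \<open>q\<close>; this settles
  their sums.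
\<close>

lemma sum_odd_even_roots:
  assumes "\<And>q. q ^ (2 * N) = 1 \<Longrightarrow> F (- q) = - F q"
  shows "(\<Sum>q::complex | q ^ (2 * N) = 1. F q :: complex) = 0"
proof -
  have "(\<Sum>q::complex | q ^ (2 * N) = 1. F (- q)) = (\<Sum>q::complex | q ^ (2 * N) = 1. - F q)"
    by (intro sum.cong refl) (simp add: assms)
  then show ?thesis using sum_even_roots_uminus[of F N] by (simp add: sum_negf)
qed

section \<open>The adjacency operator\<close>

definition neighbour_sum :: "'v set \<Rightarrow> 'v set multiset \<Rightarrow> ('v \<Rightarrow> complex) \<Rightarrow> 'v \<Rightarrow> complex" where
  "neighbour_sum V E f v = (\<Sum>u\<in>V. of_nat (count E {u, v}) * f u)"

lemma neighbour_sum_empty [simp]: "neighbour_sum V {#} f v = 0"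
  by (simp add: neighbour_sum_def)

lemma neighbour_sum_union [simp]:
  "neighbour_sum V (E + E') f v = neighbour_sum V E f v + neighbour_sum V E' f v"
  by (simp add: neighbour_sum_def distrib_right sum.distrib)

lemma neighbour_sum_mult:
  "neighbour_sum V E (\<lambda>v. c * f v) v = c * neighbour_sum V E f v"
  by (simp add: neighbour_sum_def sum_distrib_left mult_ac)

text \<open>
  Together with additivity this turns the eigenvalue equation into one summand for each edge. An edge \<open>{a, b}\<close>
  that occurs repeatedly contributes once for each occurrence.
\<close>

lemma neighbour_sum_add_mset:
  assumes "finite V" "a \<in> V" "b \<in> V" "a \<noteq> b"
  shows "neighbour_sum V (add_mset {a, b} E) f v =
    (if v = a then f b else 0) + (if v = b then f a else 0) + neighbour_sum V E f v"
proof -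
  have "neighbour_sum V {#{a, b}#} f v =
      (\<Sum>u\<in>V. (if u = b then (if v = a then f b else 0) else 0) + (if u = a then (if v = b then f a else 0) else 0))"
    unfolding neighbour_sum_def
    by (intro sum.cong refl) (use assms(4) in \<open>auto simp: doubleton_eq_iff\<close>)
  also have "\<dots> = (if v = a then f b else 0) + (if v = b then f a else 0)"
    using assms(1-3) by (simp add: sum.distrib)
  finally show ?thesis
    using neighbour_sum_union[of V "{#{a, b}#}" E f v] by simp
qed

lemma neighbour_sum_image_mset:
  assumes "finite V" "finite I" "\<And>i. i \<in> I \<Longrightarrow> a i \<in> V \<and> b i \<in> V \<and> a i \<noteq> b i"
  shows "neighbour_sum V (image_mset (\<lambda>i. {a i, b i}) (mset_set I)) f v =
    (\<Sum>i\<in>I. (if v = a i then f (b i) else 0) + (if v = b i then f (a i) else 0))"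
  using assms(2,3)
proof (induction I)
  case (insert i I)
  then show ?case
    using neighbour_sum_add_mset[OF assms(1), of "a i" "b i"] by simp
qed simp

lemma sum_path_neighbours:
  fixes f :: "nat \<Rightarrow> complex"
  shows "(\<Sum>i\<in>{a..<b}. (if v = i then f (Suc i) else 0) + (if v = Suc i then f i else 0)) =
    (if a \<le> v \<and> v < b then f (Suc v) else 0) + (if a < v \<and> v \<le> b then f (v - 1) else 0)"
proof -
  have "(\<Sum>i\<in>{a..<b}. if v = Suc i then f i else 0) =
      (\<Sum>i\<in>{a..<b}. if i = v - 1 then (if 0 < v then f (v - 1) else 0) else 0)"
    by (intro sum.cong refl) auto
  then have "(\<Sum>i\<in>{a..<b}. (if v = i then f (Suc i) else 0) + (if v = Suc i then f i else 0)) =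
    (if v \<in> {a..<b} then f (Suc v) else 0)
      + (if v - 1 \<in> {a..<b} then (if 0 < v then f (v - 1) else 0) else 0)"
    by (simp add: sum.distrib)
  also have "\<dots> = (if a \<le> v \<and> v < b then f (Suc v) else 0) + (if a < v \<and> v \<le> b then f (v - 1) else 0)"
    by (cases v) auto
  finally show ?thesis .
qed

lemma neighbour_sum_path:
  fixes f :: "nat \<Rightarrow> complex"
  assumes "finite V" "{a..b} \<subseteq> V"
  shows "neighbour_sum V (image_mset (\<lambda>i. {i, Suc i}) (mset_set {a..<b})) f v =
    (if a \<le> v \<and> v < b then f (Suc v) else 0) + (if a < v \<and> v \<le> b then f (v - 1) else 0)"
  unfolding sum_path_neighbours[symmetric]
  by (rule neighbour_sum_image_mset) (use assms in auto)

section \<open>Paths, cycles and forks\<close>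

lemma density_nonneg:
  assumes "0 < N" "q ^ (2 * N) = 1"
  shows "0 \<le> Re (1 - q ^ j)"
proof -
  have "norm q ^ (2 * N) = 1" using assms(2) by (metis norm_one norm_power)
  then have "norm q = 1" using assms(1) power_eq_imp_eq_base[of "norm q" "2 * N" 1] by simp
  then have "norm (q ^ j) = 1" by (simp add: norm_power)
  then show ?thesis using complex_Re_le_cmod[of "q ^ j"] by simp
qed

lemma \<alpha>_eq: "\<alpha> = (\<lambda>q. Re (1 - q ^ 2))" and \<beta>_eq: "\<beta> = (\<lambda>q. Re (1 - q ^ 4))"
  and \<gamma>_eq: "\<gamma> = (\<lambda>q. Re (1 - q ^ 6))"
  by (simp_all add: \<alpha>_def \<beta>_def \<gamma>_def fun_eq_iff)

text \<open>
  If \<open>q ^ (2 * n)\<close> is \<open>1\<close> or \<open>-1\<close>, reflecting the index at \<open>n\<close> changes the cosine by that sign. This produces the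
  boundary condition at the far end of a path.
\<close>

lemma cosine_reflect:
  assumes "q ^ (2 * n) = e" "e = 1 \<or> e = - 1" "j \<le> n"
  shows "cosine (n + j) q = e * cosine (n - j) q"
proof (cases "n = 0")
  case True
  then show ?thesis using assms by simp
next
  case False
  then have q: "q \<noteq> 0" using assms(1,2) by (auto simp: power_0_left)
  have "q ^ (n + j) * q ^ (n - j) = q ^ (2 * n)"
    using assms(3) by (simp add: mult_2 flip: power_add)
  then have *: "q ^ (n + j) * q ^ (n - j) = e" using assms(1) by simp
  have "q ^ (n + j) = e * inverse q ^ (n - j)"
    using * q by (simp add: field_simps)
  moreover have "inverse q ^ (n + j) = e * q ^ (n - j)"
    using * q assms(2) by (auto simp: field_simps)
  ultimately show ?thesis by (simp add: cosine_def algebra_simps)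
qed

text \<open>
  For \<open>v > 0\<close> this is the product of the sines of \<open>v\<close> times and of one times the argument of \<open>q\<close>, doubled: the
  eigenfunction of the infinite path \<open>1, 2, \<dots>\<close>, scaled to the value \<open>\<alpha> q\<close> at the root \<open>1\<close>. At \<open>v = 0\<close>
  the truncated subtraction does not give the boundary value zero, so the vertex \<open>1\<close> is treated
  separately in the recurrence.
\<close>

definition cosine_diff :: "nat \<Rightarrow> complex \<Rightarrow> complex" where
  "cosine_diff v q = cosine (v - 1) q - cosine (v + 1) q"

lemma cosine_diff_step:
  assumes "q \<noteq> 0" "0 < v"
  shows "(q + inverse q) * cosine_diff v q = cosine_diff (Suc v) q + (if 1 < v then cosine_diff (v - 1) q else 0)"
proof (cases "v = 1")
  case True
  have "q + inverse q = 2 * cosine 1 q" by (simp add: cosine_def)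
  then show ?thesis
    using True cosine_step[OF assms(1), of 1]
    by (simp add: cosine_diff_def right_diff_distrib numeral_2_eq_2 numeral_3_eq_3)
next
  case False
  then obtain w where w: "v = Suc (Suc w)" using assms(2) by (metis One_nat_def gr0_implies_Suc not0_implies_Suc)
  show ?thesis
    using cosine_step[OF assms(1), of w] cosine_step[OF assms(1), of "Suc (Suc w)"]
    by (simp add: w cosine_diff_def right_diff_distrib)
qed

text \<open>
  The eigenfunctions of the infinite path, restricted by the boundary value zero at \<open>n\<close>, which holds at the
  \<open>2 n\<close>-th roots of unity. The factor \<open>\<alpha>\<close> is part of \<open>cosine_diff\<close>.
\<close>

lemma circular_measure_A:
  assumes "3 \<le> n"
  shows "circular_measure (graph_A (n - 1)) = weighted \<alpha> (d n)"
proof (rule circular_measure_eqI[where N = n and F = "\<lambda>v q. of_real (d n {q}) * cosine_diff v q"],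
    fold neighbour_sum_def)
  have n: "0 < n" using assms by simp
  show "0 < n" by (rule n)
  show "symmetric_on_roots n (weighted \<alpha> (d n))"
    unfolding \<alpha>_eq using n by (intro symmetric_on_roots_weighted_density symmetric_on_roots_d) auto
  fix v and q :: complex
  show "finite (verts (graph_A (n - 1)))" "root (graph_A (n - 1)) \<in> verts (graph_A (n - 1))"
    using assms by (auto simp: graph_A_def)
  show "(\<Sum>q | q ^ (2 * n) = 1. of_real (d n {q}) * cosine_diff v q) =
      (if v = root (graph_A (n - 1)) then 1 else 0)" if "v \<in> verts (graph_A (n - 1))"
  proof -
    have v: "1 \<le> v" "v \<le> n - 1" using that by (auto simp: graph_A_def)
    have "\<not> 2 * n dvd v + 1" "2 * n dvd v - 1 \<longleftrightarrow> v = 1"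
      using v assms by (auto dest!: dvd_imp_le)
    then have "pairing n (d n) (\<lambda>q. cosine (v - 1) q - cosine (v + 1) q) = (if v = 1 then 1 else 0)"
      unfolding pairing_function_linear using n by (simp add: pairing_d)
    then show ?thesis by (simp only: pairing_def cosine_diff_def) (simp add: graph_A_def)
  qed
  assume q: "q ^ (2 * n) = 1"
  note q0 = root_of_unity_unit(1)[OF n q]
  show "0 \<le> weighted \<alpha> (d n) {q}"
    using density_nonneg[OF n q] n by (simp add: weighted_singleton \<alpha>_eq d_singleton)
  show "of_real (d n {q}) * cosine_diff (root (graph_A (n - 1))) q = of_real (weighted \<alpha> (d n) {q})"
    using of_real_density[OF n q, of 2]
    by (simp add: weighted_singleton \<alpha>_eq graph_A_def cosine_diff_def numeral_2_eq_2)
  show "(q + inverse q) * (of_real (d n {q}) * cosine_diff v q) =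
      neighbour_sum (verts (graph_A (n - 1))) (edges (graph_A (n - 1)))
        (\<lambda>v. of_real (d n {q}) * cosine_diff v q) v" if "v \<in> verts (graph_A (n - 1))"
  proof -
    have v: "1 \<le> v" "v \<le> n - 1" using that by (auto simp: graph_A_def)
    \<comment> \<open>The eigenvalue equation at the last vertex \<open>n - 1\<close> is the recurrence with the value at \<open>n\<close> omitted.\<close>
    have "cosine_diff n q = 0"
      using cosine_reflect[OF q, of 1] assms by (simp add: cosine_diff_def)
    moreover have "v = n - 1 \<Longrightarrow> Suc v = n" using n by simp
    ultimately have "(q + inverse q) * cosine_diff v q =
        (if v < n - 1 then cosine_diff (Suc v) q else 0) + (if 1 < v then cosine_diff (v - 1) q else 0)"
      using cosine_diff_step[OF q0, of v] v by (cases "v = n - 1") auto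
    note * = this
    show ?thesis
      unfolding mult.left_commute[of "q + inverse q"] * distrib_left
      using v assms by (auto simp: graph_A_def neighbour_sum_path)
  qed
qed

text \<open>
  Folding the path \<open>1, \<dots>, 2 n - 1\<close> at its middle vertex \<open>n\<close>: the function symmetric about \<open>n\<close> lives on the odd
  \<open>4 n\<close>-th roots of unity, and its value at \<open>n\<close> is shared by the two leaves.
\<close>

lemma circular_measure_D:
  assumes "2 \<le> n"
  shows "circular_measure (graph_D (n + 1)) = weighted \<alpha> (d' n)"
proof (rule circular_measure_eqI[where N = "2 * n" and
      F = "\<lambda>v q. of_real (d' n {q}) * (if v < n then cosine_diff v q else cosine_diff n q / 2)"],
    fold neighbour_sum_def)
  let ?X = "graph_D (n + 1)"
  obtain k where k: "n = Suc (Suc k)" using assms by (metis add_2_eq_Suc le_Suc_ex)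
  let ?F = "\<lambda>v q. complex_of_real (d' n {q}) * (if v < n then cosine_diff v q else cosine_diff n q / 2)"
  have n: "0 < n" "0 < 2 * n" using assms by simp_all
  show "0 < 2 * n" by (rule n)
  show "symmetric_on_roots (2 * n) (weighted \<alpha> (d' n))"
    unfolding \<alpha>_eq d'_def using n
    by (intro symmetric_on_roots_weighted_density symmetric_on_roots_diff symmetric_on_roots_mult
        symmetric_on_roots_d) auto
  have X: "verts ?X = {1..n + 1}" "root ?X = 1"
    "edges ?X = image_mset (\<lambda>i. {i, Suc i}) (mset_set {1..<n - 1}) + {# {n - 1, n}, {n - 1, n + 1} #}"
    using assms by (auto simp: graph_D_def numeral_2_eq_2)
  fix v and q :: complex
  show "finite (verts ?X)" "root ?X \<in> verts ?X" unfolding X by auto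
  show "(\<Sum>q | q ^ (2 * (2 * n)) = 1. ?F v q) = (if v = root ?X then 1 else 0)" if "v \<in> verts ?X"
  proof -
    define w where "w = (if v < n then v else n)"
    define c :: complex where "c = (if v < n then 1 else 1 / 2)"
    have w: "1 \<le> w" "w \<le> n" "w = 1 \<longleftrightarrow> v = 1" "v = 1 \<Longrightarrow> c = 1"
      using that[unfolded X] assms by (auto simp: w_def c_def)
    have nd: "\<not> 2 * n dvd w + 1" "2 * n dvd w - 1 \<longleftrightarrow> w = 1" "\<not> 4 * n dvd w + 1" "4 * n dvd w - 1 \<longleftrightarrow> w = 1"
      using w assms by (auto dest!: dvd_imp_le)
    have "?F v q = complex_of_real (d' n {q}) * (c * (cosine (w - 1) q - cosine (w + 1) q))" for q
      by (auto simp: w_def c_def cosine_diff_def)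
    then have "(\<Sum>q | q ^ (2 * (2 * n)) = 1. ?F v q) =
        pairing (2 * n) (d' n) (\<lambda>q. c * (cosine (w - 1) q - cosine (w + 1) q))"
      by (simp only: pairing_def)
    also have "\<dots> = (if w = 1 then c else 0)"
      unfolding pairing_function_linear using n nd by (simp add: pairing_d')
    finally show ?thesis unfolding X using w by auto
  qed
  assume q: "q ^ (2 * (2 * n)) = 1"
  note q0 = root_of_unity_unit(1)[OF n(2) q]
  show "0 \<le> weighted \<alpha> (d' n) {q}"
    using density_nonneg[OF n(2) q] n by (simp add: weighted_singleton \<alpha>_eq d'_singleton)
  show "?F (root ?X) q = of_real (weighted \<alpha> (d' n) {q})"
    using of_real_density[OF n(2) q, of 2] assms
    unfolding X by (simp add: weighted_singleton \<alpha>_eq cosine_diff_def numeral_2_eq_2)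
  show "(q + inverse q) * ?F v q = neighbour_sum (verts ?X) (edges ?X) (\<lambda>v. ?F v q) v"
    if "v \<in> verts ?X"
  proof (cases "d' n {q} = 0")
    case True
    then show ?thesis by (simp add: neighbour_sum_def)
  next
    case False
    then have qn: "q ^ (2 * n) = - 1" using n by (simp add: d'_singleton split: if_splits)
    define G where "G v = (if v < n then cosine_diff v q else cosine_diff n q / 2)" for v
    have step: "(q + inverse q) * G v = G (Suc v) + (if 1 < v then G (v - 1) else 0)"
      if "0 < v" "v < n - 1" for v
      using cosine_diff_step[OF q0 that(1)] that by (auto simp: G_def algebra_simps)
    have last: "(q + inverse q) * G (n - 1) = G n + G (n + 1) + (if 1 < n - 1 then G (n - 2) else 0)"
      using cosine_diff_step[OF q0, of "n - 1"] assms
      by (auto simp: G_def algebra_simps numeral_2_eq_2)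
    \<comment> \<open>The reflection at \<open>n\<close> turns the recurrence at \<open>n\<close> into the equation at a leaf, where half of
      \<open>cosine_diff n\<close> is placed.\<close>
    have "cosine n q = 0" "cosine (n + 2) q = - cosine (n - 2) q"
      using cosine_reflect[OF qn, of 0] cosine_reflect[OF qn, of 2] assms by auto
    then have "cosine_diff (Suc n) q = cosine_diff (n - 1) q"
      using assms by (simp add: cosine_diff_def numeral_2_eq_2 Suc_diff_Suc)
    then have leaf: "(q + inverse q) * G n = G (n - 1)" "G (n + 1) = G n"
      using cosine_diff_step[OF q0, of n] assms by (auto simp: G_def algebra_simps)
    have "(q + inverse q) * G v = neighbour_sum (verts ?X) (edges ?X) G v"
    proof -
      have "v \<in> {1..<n - 1} \<or> v = n - 1 \<or> v = n \<or> v = n + 1"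
        using that[unfolded X] by auto
      moreover have "neighbour_sum (verts ?X) (edges ?X) G v =
          (if 1 \<le> v \<and> v < n - 1 then G (Suc v) else 0) + (if 1 < v \<and> v \<le> n - 1 then G (v - 1) else 0)
          + ((if v = n - 1 then G n else 0) + (if v = n then G (n - 1) else 0)
          + ((if v = n - 1 then G (n + 1) else 0) + (if v = n + 1 then G (n - 1) else 0)))"
        unfolding X neighbour_sum_union unfolding k by (simp add: neighbour_sum_path neighbour_sum_add_mset)
      ultimately show ?thesis
        using step[of v] last leaf unfolding k by (elim disjE) (simp_all add: numeral_2_eq_2 cong: if_cong)
    qed
    then show ?thesis
      unfolding neighbour_sum_mult mult.left_commute[of "q + inverse q"] G_def by simp
  qed
qed

text \<open>
  The characters of the cyclic group are eigenfunctions with equal masses. The edges are indexed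
  by the \<open>2 n\<close> vertices also for \<open>n = 1\<close>, so the double edge needs no separate treatment.
\<close>

lemma circular_measure_affine_A:
  assumes "1 \<le> n"
  shows "circular_measure (affine_A (2 * n)) = d n"
proof (rule circular_measure_eqI[where N = n and F = "\<lambda>v q. of_real (d n {q}) * q ^ v"],
    fold neighbour_sum_def)
  let ?X = "affine_A (2 * n)"
  let ?F = "\<lambda>v q. complex_of_real (d n {q}) * q ^ v"
  have n: "0 < n" using assms by simp
  show "0 < n" by (rule n)
  show "symmetric_on_roots n (d n)" using n by (intro symmetric_on_roots_d) auto
  have X: "verts ?X = {0..<2 * n}" "root ?X = 0"
    "edges ?X = image_mset (\<lambda>i. {i, Suc i mod (2 * n)}) (mset_set {0..<2 * n})"
    by (auto simp: affine_A_def)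
  fix v and q :: complex
  show "finite (verts ?X)" "root ?X \<in> verts ?X" unfolding X using n by auto
  show "(\<Sum>q | q ^ (2 * n) = 1. ?F v q) = (if v = root ?X then 1 else 0)" if "v \<in> verts ?X"
  proof -
    have "2 * n dvd v \<longleftrightarrow> v = 0" using that unfolding X by (auto dest!: dvd_imp_le)
    then show ?thesis using pairing_d_power[of n n v] n by (simp add: X pairing_def)
  qed
  assume q: "q ^ (2 * n) = 1"
  note q0 = root_of_unity_unit(1)[OF n q]
  show "0 \<le> d n {q}" using n by (simp add: d_singleton)
  show "?F (root ?X) q = of_real (d n {q})" by (simp add: X)
  show "(q + inverse q) * ?F v q = neighbour_sum (verts ?X) (edges ?X) (\<lambda>v. ?F v q) v"
    if "v \<in> verts ?X"
  proof -
    have v: "v < 2 * n" using that by (simp add: X)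
    have next_power: "q ^ (Suc i mod (2 * n)) = q * q ^ i" for i
    proof -
      have "q ^ Suc i = q ^ (2 * n * (Suc i div (2 * n)) + Suc i mod (2 * n))" by simp
      then show ?thesis using q by (simp only: power_add power_mult[of q "2 * n"]) simp
    qed
    \<comment> \<open>The predecessor of \<open>v\<close> on the cycle.\<close>
    define p where "p = (if v = 0 then 2 * n - 1 else v - 1)"
    have p: "p < 2 * n" "v = Suc i mod (2 * n) \<longleftrightarrow> i = p" if "i < 2 * n" for i
      using v that n by (auto simp: p_def mod_Suc)
    have "Suc p mod (2 * n) = v" using p[of p] v n by (auto simp: p_def)
    then have prev_power: "inverse q * q ^ v = q ^ p" using next_power[of p] q0 by simp
    have "neighbour_sum (verts ?X) (edges ?X) (\<lambda>v. ?F v q) v =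
        (\<Sum>i\<in>{0..<2 * n}. (if v = i then ?F (Suc i mod (2 * n)) q else 0)
          + (if v = Suc i mod (2 * n) then ?F i q else 0))"
      unfolding X
    proof (rule neighbour_sum_image_mset)
      have "i \<noteq> 0" if "Suc i = 2 * n" for i using that by presburger
      then show "i \<in> {0..<2 * n} \<and> Suc i mod (2 * n) \<in> {0..<2 * n} \<and> i \<noteq> Suc i mod (2 * n)"
        if "i \<in> {0..<2 * n}" for i
        using that by (auto simp: mod_Suc)
    qed auto
    also have "\<dots> = (\<Sum>i\<in>{0..<2 * n}. (if v = i then ?F (Suc i mod (2 * n)) q else 0)
          + (if i = p then ?F i q else 0))"
      by (intro sum.cong refl) (use p in auto)
    also have "\<dots> = ?F (Suc v mod (2 * n)) q + ?F p q"
      using v p(1)[of v] by (simp add: sum.distrib)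
    finally show ?thesis
      using next_power[of v] prev_power by (simp add: algebra_simps)
  qed
qed

lemma circular_measure_affine_D:
  assumes "2 \<le> n"
  shows "circular_measure (affine_D (n + 2)) = (\<lambda>B. (d n B + d' 1 B) / 2)"
proof -
  \<comment> \<open>The unit vector at the root is half the sum plus half the difference of the unit vectors at
    \<open>n\<close> and its twin leaf \<open>n + 1\<close>. The sum generates the eigenfunctions \<open>g\<close>, symmetric under
    the exchange of twin leaves; the difference \<open>h\<close> is itself an eigenfunction, with eigenvalue \<open>0\<close>,
    which is the value of \<open>q + 1/q\<close> at the support \<open>{i, -i}\<close> of \<open>d' 1\<close>.\<close>
  define g where "g v q = (if v < n then 2 * cosine v q else if v \<le> n + 1 then 1 else cosine n q)" for v q
  define h :: "nat \<Rightarrow> complex" where "h v = (if v = n then 1 else if v = n + 1 then - 1 else 0)" for v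
  define F where "F v q = (of_real (d n {q}) * g v q + of_real (d' 1 {q}) * h v) / 2" for v q
  let ?X = "affine_D (n + 2)"
  let ?m = "\<lambda>B. (d n B + d' 1 B) / 2"
  obtain k where k: "n = Suc (Suc k)" using assms by (metis add_2_eq_Suc le_Suc_ex)
  have n: "0 < n" "0 < 2 * n" using assms by simp_all
  have X: "verts ?X = {1..n + 3}" "root ?X = n"
    "edges ?X = image_mset (\<lambda>i. {i, Suc i}) (mset_set {1..<n - 1})
       + {# {1, n}, {1, n + 1}, {n - 1, n + 2}, {n - 1, n + 3} #}"
    using assms by (auto simp: affine_D_def numeral_2_eq_2 numeral_3_eq_3)
  show ?thesis
  proof (rule circular_measure_eqI[where N = "2 * n" and F = F], fold neighbour_sum_def)
    show "0 < 2 * n" by (rule n)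
    show "symmetric_on_roots (2 * n) ?m"
      unfolding d'_def using n
      by (intro symmetric_on_roots_divide symmetric_on_roots_add symmetric_on_roots_diff
          symmetric_on_roots_mult symmetric_on_roots_d) auto
    fix v and q :: complex
    show "finite (verts ?X)" "root ?X \<in> verts ?X" unfolding X using assms by auto
    show "(\<Sum>q | q ^ (2 * (2 * n)) = 1. F v q) = (if v = root ?X then 1 else 0)" if "v \<in> verts ?X"
    proof -
      define w where "w = (if v < n then v else if v \<le> n + 1 then 0 else n)"
      define c :: complex where "c = (if v < n then 2 else 1)"
      have "(\<Sum>q | q ^ (2 * (2 * n)) = 1. F v q) =
          (c * pairing (2 * n) (d n) (cosine w) + h v * pairing (2 * n) (d' 1) (cosine 0)) / 2"
        by (auto simp: F_def g_def w_def c_def pairing_def sum.distrib sum_distrib_left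
            sum_divide_distrib add_divide_distrib algebra_simps)
      also have "pairing (2 * n) (d n) (cosine w) = (if v = n \<or> v = n + 1 then 1 else 0)"
        using that[unfolded X] assms n by (auto simp: pairing_d w_def dest!: dvd_imp_le)
      also have "pairing (2 * n) (d' 1) (cosine 0) = 1"
        using pairing_d'[of "2 * n" 1 0] n by simp
      finally show ?thesis unfolding X using assms by (cases "v = n + 1") (auto simp: h_def c_def)
    qed
    assume q: "q ^ (2 * (2 * n)) = 1"
    note q0 = root_of_unity_unit(1)[OF n(2) q]
    show "0 \<le> ?m {q}" using n by (simp add: d_singleton d'_singleton)
    show "F (root ?X) q = of_real (?m {q})" unfolding X by (simp add: F_def g_def h_def)
    define E where "E f v = neighbour_sum (verts ?X) (edges ?X) f v" for f v
    have E: "E f v =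
          (if 1 \<le> v \<and> v < n - 1 then f (Suc v) else 0) + (if 1 < v \<and> v \<le> n - 1 then f (v - 1) else 0)
          + ((if v = 1 then f n else 0) + (if v = n then f 1 else 0)
          + ((if v = 1 then f (n + 1) else 0) + (if v = n + 1 then f 1 else 0)
          + ((if v = n - 1 then f (n + 2) else 0) + (if v = n + 2 then f (n - 1) else 0)
          + ((if v = n - 1 then f (n + 3) else 0) + (if v = n + 3 then f (n - 1) else 0)))))" for f v
      unfolding E_def X neighbour_sum_union unfolding k
      by (simp add: neighbour_sum_path neighbour_sum_add_mset) (simp add: numeral_2_eq_2)
    show "(q + inverse q) * F v q = neighbour_sum (verts ?X) (edges ?X) (\<lambda>v. F v q) v"
      if "v \<in> verts ?X"
    proof -
      have linear: "E (\<lambda>v. F v q) v = (of_real (d n {q}) * E (\<lambda>v. g v q) v + of_real (d' 1 {q}) * E h v) / 2"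
        unfolding E_def neighbour_sum_def F_def
        by (simp add: sum_distrib_left sum_divide_distrib sum.distrib add_divide_distrib algebra_simps)
      have g: "(q + inverse q) * g v q = E (\<lambda>v. g v q) v" if "d n {q} \<noteq> 0"
      proof -
        have qn: "q ^ (2 * n) = 1" using \<open>d n {q} \<noteq> 0\<close> n by (simp add: d_singleton split: if_splits)
        have x: "q + inverse q = 2 * cosine 1 q" by (simp add: cosine_def)
        have inner: "(q + inverse q) * cosine k q = cosine (Suc k) q + cosine (k - 1) q" if "0 < k" for k
          using cosine_step[OF q0, of "k - 1"] that by simp
        have end_leaf: "(q + inverse q) * cosine n q = 2 * cosine (n - 1) q"
          using inner[OF n(1)] cosine_reflect[OF qn, of 1] n by simp
        have "v \<in> {1..<n} \<or> v = n \<or> v = n + 1 \<or> v = n + 2 \<or> v = n + 3" using that \<open>v \<in> verts ?X\<close> unfolding X by auto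
        then show ?thesis
        proof (elim disjE)
          assume v: "v \<in> {1..<n}"
          have "(q + inverse q) * g v q = 2 * cosine (Suc v) q + 2 * cosine (v - 1) q"
            using inner[of v] v by (simp add: g_def algebra_simps)
          also have "\<dots> = E (\<lambda>v. g v q) v"
          proof -
            have "v = n - 1 \<Longrightarrow> Suc v = n" using n by simp
            then show ?thesis using v assms by (cases "v = n - 1"; cases "v = 1") (auto simp: E g_def)
          qed
          finally show ?thesis .
        qed (use assms x end_leaf in \<open>auto simp: E g_def\<close>)
      qed
      have h: "(q + inverse q) * h v = E h v" if "d' 1 {q} \<noteq> 0"
      proof -
        have "q ^ 2 = - 1" using \<open>d' 1 {q} \<noteq> 0\<close> by (simp add: d'_singleton split: if_splits)
        then have "q * - q = 1" by (simp add: power2_eq_square)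
        then have "inverse q = - q" by (rule inverse_unique)
        then have "q + inverse q = 0" by simp
        then show ?thesis by (auto simp: E h_def k)
      qed
      have "(q + inverse q) * F v q =
          (of_real (d n {q}) * ((q + inverse q) * g v q) + of_real (d' 1 {q}) * ((q + inverse q) * h v)) / 2"
        by (simp add: F_def algebra_simps)
      also have "\<dots> = E (\<lambda>v. F v q) v"
        unfolding linear using g h by (cases "d n {q} = 0"; cases "d' 1 {q} = 0") simp_all
      finally show ?thesis by (simp add: E_def)
    qed
  qed
qed

section \<open>Graphs with three legs\<close>

lemma leg_vertex_eq_iff:
  assumes "0 < j" "0 < j'"
  shows "leg_vertex j i = leg_vertex j' i' \<longleftrightarrow> i = i' \<and> (j = j' \<or> i = 0)"
  using assms by (auto simp: leg_vertex_def)

lemma neighbour_sum_leg: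
  assumes "finite V" "leg_vertex j' ` {0..l} \<subseteq> V" "0 < j" "0 < j'"
  shows "neighbour_sum V (leg_edges j' l) f (leg_vertex j i) =
    (if j = j' \<or> i = 0 then (if i < l then f (leg_vertex j' (Suc i)) else 0) +
      (if 0 < i \<and> i \<le> l then f (leg_vertex j' (i - 1)) else 0) else 0)"
proof -
  have "neighbour_sum V (leg_edges j' l) f (leg_vertex j i) =
      (\<Sum>k\<in>{0..<l}. (if leg_vertex j i = leg_vertex j' k then f (leg_vertex j' (Suc k)) else 0)
        + (if leg_vertex j i = leg_vertex j' (Suc k) then f (leg_vertex j' k) else 0))"
    unfolding leg_edges_def
    by (rule neighbour_sum_image_mset) (use assms in \<open>auto simp: leg_vertex_eq_iff image_subset_iff\<close>)
  also have "\<dots> = (if j = j' \<or> i = 0 then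
      (\<Sum>k\<in>{0..<l}. (if i = k then f (leg_vertex j' (Suc k)) else 0)
        + (if i = Suc k then f (leg_vertex j' k) else 0)) else 0)"
    using assms(3,4) by (auto simp: leg_vertex_eq_iff intro!: sum.cong sum.neutral)
  finally show ?thesis
    using sum_path_neighbours[of i "\<lambda>k. f (leg_vertex j' k)" 0 l] by simp
qed

text \<open>
  A function on the graph is a sequence on each leg, with a common value at the centre. The eigenvalue equations
  are a three-term recurrence along each leg, continued by the value zero beyond its end, and one
  equation at the centre.
\<close>

lemma neighbour_sum_three_legs:
  fixes f :: "nat \<times> nat \<Rightarrow> complex" and P :: "nat \<Rightarrow> nat \<Rightarrow> complex" and a b c :: nat
  defines "l \<equiv> \<lambda>j::nat. if j = 1 then a else if j = 2 then b else c"
  assumes f: "\<And>j i. j \<in> {1, 2, 3} \<Longrightarrow> f (leg_vertex j i) = P j i"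
    and step: "\<And>j i. j \<in> {1, 2, 3} \<Longrightarrow> 0 < i \<Longrightarrow> i \<le> l j \<Longrightarrow> x * P j i = P j (Suc i) + P j (i - 1)"
    and last: "\<And>j. j \<in> {1, 2, 3} \<Longrightarrow> P j (Suc (l j)) = 0"
    and centre: "x * P 1 0 = P 1 1 + P 2 1 + P 3 1"
    and v: "v \<in> verts (three_legs a b c)"
  shows "neighbour_sum (verts (three_legs a b c)) (edges (three_legs a b c)) f v = x * f v"
proof -
  let ?V = "verts (three_legs a b c)"
  have fin: "finite ?V" by (simp add: three_legs_def)
  have sub: "leg_vertex 1 ` {0..a} \<subseteq> ?V" "leg_vertex 2 ` {0..b} \<subseteq> ?V" "leg_vertex 3 ` {0..c} \<subseteq> ?V"
    by (auto simp: three_legs_def)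
  note leg_sum = neighbour_sum_leg[OF fin sub(1), simplified]
    neighbour_sum_leg[OF fin sub(2), simplified] neighbour_sum_leg[OF fin sub(3), simplified]
  have E: "edges (three_legs a b c) = leg_edges 1 a + leg_edges 2 b + leg_edges 3 c"
    by (simp add: three_legs_def)
  obtain j i where j: "j \<in> {1, 2, 3}" and i: "i \<le> l j" and vji: "v = leg_vertex j i"
    using v by (fastforce simp: three_legs_def l_def)
  show ?thesis
  proof (cases "i = 0")
    case True
    have "v = leg_vertex 1 0" by (simp add: vji True leg_vertex_def)
    moreover have "0 < a \<or> P 1 1 = 0" using last[of 1] by (cases a) (auto simp: l_def)
    moreover have "0 < b \<or> P 2 1 = 0" using last[of 2] by (cases b) (auto simp: l_def)
    moreover have "0 < c \<or> P 3 1 = 0" using last[of 3] by (cases c) (auto simp: l_def)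
    ultimately show ?thesis
      using centre unfolding E neighbour_sum_union
      by (auto simp: leg_sum f)
  next
    case False
    have "neighbour_sum ?V (edges (three_legs a b c)) f v =
        (if i < l j then P j (Suc i) else 0) + P j (i - 1)"
      using False j i unfolding E neighbour_sum_union vji
      by (auto simp: leg_sum f l_def)
    moreover have "i < l j \<or> P j (Suc i) = 0" using last[OF j] i by (cases "i = l j") auto
    ultimately show ?thesis using step[OF j _ i] False j by (auto simp: vji f)
  qed
qed

text \<open>
  The solution of the recurrence with initial values \<open>y\<close> and \<open>z\<close>. For \<open>y = 0\<close> and \<open>z = 1\<close> these are the Chebyshev
  polynomials of the second kind in \<open>x / 2\<close>.
\<close>

fun three_term :: "complex \<Rightarrow> complex \<Rightarrow> complex \<Rightarrow> nat \<Rightarrow> complex" where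
  "three_term x y z 0 = y"
| "three_term x y z (Suc 0) = z"
| "three_term x y z (Suc (Suc n)) = x * three_term x y z (Suc n) - three_term x y z n"

lemma three_term_mult: "three_term x (s * y) (s * z) n = s * three_term x y z n"
  by (induction x y z n rule: three_term.induct) (simp_all add: algebra_simps)

lemma three_term_uminus: "three_term (- x) y (- z) n = (- 1) ^ n * three_term x y z n"
  by (induction x y z n rule: three_term.induct) (simp_all add: algebra_simps)

text \<open>
  Starting at the root, the recurrence determines the values \<open>U\<close> on the first leg up to the centre, which has
  \<open>U (a + 1)\<close>. The equation at the centre leaves one choice, the value \<open>Y\<close> next to the centre on the second leg;
  then \<open>Z\<close> is the value next to the centre on the third leg. What remains are the boundary conditions at
  the ends of these legs and orthogonality at the vertices of even distance from the root, since parity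
  settles the others. The parity of \<open>Y\<close> is prescribed by the distance \<open>a + 1\<close>.
\<close>

lemma circular_measure_three_legs:
  fixes m :: "complex set \<Rightarrow> real" and Y :: "complex \<Rightarrow> complex" and a b c :: nat
  defines "U \<equiv> \<lambda>k q. three_term (q + inverse q) 0 (of_real (m {q})) k"
  defines "V \<equiv> \<lambda>Y k q. three_term (q + inverse q) (U (a + 1) q) (Y q) k"
  defines "Z \<equiv> \<lambda>q. U (a + 2) q - Y q"
  assumes N: "0 < N" and m: "symmetric_on_roots N m"
    and nonneg: "\<And>q. q ^ (2 * N) = 1 \<Longrightarrow> 0 \<le> m {q}"
    and Y_parity: "\<And>q. q ^ (2 * N) = 1 \<Longrightarrow> Y (- q) = (- 1) ^ (a + 1) * Y q"
    and last: "\<And>q. q ^ (2 * N) = 1 \<Longrightarrow> V Y (b + 1) q = 0"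
      "\<And>q. q ^ (2 * N) = 1 \<Longrightarrow> V Z (c + 1) q = 0"
    and total: "pairing N m (cosine 0) = 1"
    and orth1: "\<And>k. odd k \<Longrightarrow> 1 < k \<Longrightarrow> k \<le> a + 1 \<Longrightarrow> (\<Sum>q | q ^ (2 * N) = 1. U k q) = 0"
    and orth2: "\<And>k. even (a + k) \<Longrightarrow> 0 < k \<Longrightarrow> k \<le> b \<Longrightarrow> (\<Sum>q | q ^ (2 * N) = 1. V Y k q) = 0"
    and orth3: "\<And>k. even (a + k) \<Longrightarrow> 0 < k \<Longrightarrow> k \<le> c \<Longrightarrow> (\<Sum>q | q ^ (2 * N) = 1. V Z k q) = 0"
  shows "circular_measure (three_legs a b c) = m"
proof -
  let ?X = "three_legs a b c"
  define P where "P j i q = (if j = 2 then V Y i q else if j = 3 then V Z i q else U (a + 1 - i) q)"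
    for j i :: nat and q
  define F where "F v q = P (fst v) (snd v) q" for v q
  have P0: "P j 0 q = U (a + 1) q" for j q by (simp add: P_def V_def)
  have F: "F (leg_vertex j i) q = P j i q" if "0 < j" for j i q
    using that P0 by (simp add: F_def leg_vertex_def)
  have rec: "(q + inverse q) * U (Suc k) q = U (Suc (Suc k)) q + U k q"
    "(q + inverse q) * V W (Suc k) q = V W (Suc (Suc k)) q + V W k q" for W k q
    by (simp_all add: U_def V_def)
  have U0: "U 0 q = 0" for q by (simp add: U_def)
  have neg: "- q + inverse (- q) = - (q + inverse q)" for q :: complex by simp
  have U_neg: "U k (- q) = (- 1) ^ (k + 1) * U k q" for k q
  proof -
    have "U k (- q) = three_term (- (q + inverse q)) (- 1 * 0) (- 1 * - of_real (m {q})) k"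
      unfolding U_def neg symmetric_on_rootsD(2)[OF m] by simp
    then show ?thesis unfolding three_term_mult three_term_uminus by (simp add: U_def)
  qed
  have V_neg: "V W k (- q) = (- 1) ^ (a + k) * V W k q" if "W (- q) = (- 1) ^ (a + 1) * W q" for W k q
  proof -
    have "V W k (- q) = three_term (- (q + inverse q)) ((- 1) ^ a * U (a + 1) q) ((- 1) ^ a * - W q) k"
      unfolding V_def neg U_neg that by simp
    then show ?thesis
      unfolding three_term_mult three_term_uminus by (simp add: V_def power_add)
  qed
  \<comment> \<open>Both legs alternate in parity, because \<open>m\<close> is symmetric and \<open>q + 1/q\<close> is odd.\<close>
  have Z_parity: "Z (- q) = (- 1) ^ (a + 1) * Z q" if "q ^ (2 * N) = 1" for q
  proof -
    have "Z (- q) = (- 1) ^ (a + 1) * (U (a + 2) q - Y q)"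
      unfolding Z_def U_neg Y_parity[OF that] by (simp add: algebra_simps)
    then show ?thesis by (simp only: Z_def)
  qed
  show ?thesis
  proof (rule circular_measure_eqI[where F = F], fold neighbour_sum_def)
    show "0 < N" "symmetric_on_roots N m" by fact+
    have root: "root ?X = leg_vertex 1 a" by (simp add: three_legs_def)
    fix v and q :: complex
    show "finite (verts ?X)" "root ?X \<in> verts ?X" by (auto simp: three_legs_def)
    show "(\<Sum>q | q ^ (2 * N) = 1. F v q) = (if v = root ?X then 1 else 0)" if "v \<in> verts ?X"
    proof -
      have leg1: "(\<Sum>q | q ^ (2 * N) = 1. U k q) = (if k = 1 then 1 else 0)" if "0 < k" "k \<le> a + 1" for k
      proof (cases "odd k")
        case True
        have "(\<Sum>q | q ^ (2 * N) = 1. U 1 q) = 1" using total by (simp add: pairing_def U_def)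
        then show ?thesis using orth1[OF True] that by (cases "k = 1") auto
      next
        case False
        then have "k \<noteq> 1" by auto
        then show ?thesis using False by (auto intro!: sum_odd_even_roots simp: U_neg)
      qed
      have leg2: "(\<Sum>q | q ^ (2 * N) = 1. V Y k q) = 0" if "0 < k" "k \<le> b" for k
        using orth2[OF _ that] V_neg Y_parity
        by (cases "even (a + k)") (auto intro!: sum_odd_even_roots)
      have leg3: "(\<Sum>q | q ^ (2 * N) = 1. V Z k q) = 0" if "0 < k" "k \<le> c" for k
        using orth3[OF _ that] V_neg Z_parity
        by (cases "even (a + k)") (auto intro!: sum_odd_even_roots)
      have on_leg1: "(\<Sum>q | q ^ (2 * N) = 1. F (leg_vertex 1 i) q) = (if leg_vertex 1 i = root ?X then 1 else 0)"
        if "i \<le> a" for i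
      proof -
        have "(\<Sum>q | q ^ (2 * N) = 1. F (leg_vertex 1 i) q) = (\<Sum>q | q ^ (2 * N) = 1. U (a + 1 - i) q)"
          by (simp add: F P_def)
        also have "\<dots> = (if a + 1 - i = 1 then 1 else 0)" using that by (intro leg1) auto
        also have "a + 1 - i = 1 \<longleftrightarrow> leg_vertex 1 i = root ?X"
          using that by (auto simp: root leg_vertex_eq_iff)
        finally show ?thesis .
      qed
      have centre: "leg_vertex j 0 = leg_vertex 1 0" for j by (simp add: leg_vertex_def)
      have "v \<in> leg_vertex 1 ` {0..a} \<union> leg_vertex 2 ` {0..b} \<union> leg_vertex 3 ` {0..c}"
        using that by (simp add: three_legs_def)
      then consider i where "i \<le> a" "v = leg_vertex 1 i" | i where "i \<le> b" "v = leg_vertex 2 i"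
        | i where "i \<le> c" "v = leg_vertex 3 i"
        by auto
      then show ?thesis
      proof cases
        case (1 i)
        then show ?thesis using on_leg1 by simp
      next
        case (2 i)
        show ?thesis
        proof (cases "i = 0")
          case True
          then show ?thesis using on_leg1[of 0] 2 centre[of 2] by simp
        next
          case False
          then have "v \<noteq> root ?X" using 2 by (simp add: root leg_vertex_eq_iff)
          then show ?thesis using leg2[of i] 2 False by (simp add: F P_def)
        qed
      next
        case (3 i)
        show ?thesis
        proof (cases "i = 0")
          case True
          then show ?thesis using on_leg1[of 0] 3 centre[of 3] by simp
        next
          case False
          then have "v \<noteq> root ?X" using 3 by (simp add: root leg_vertex_eq_iff)
          then show ?thesis using leg3[of i] 3 False by (simp add: F P_def)
        qed
      qed
    qed
    assume q: "q ^ (2 * N) = 1"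
    show "0 \<le> m {q}" using nonneg[OF q] .
    show "F (root ?X) q = of_real (m {q})" by (simp add: root F P_def U_def)
    show "(q + inverse q) * F v q = neighbour_sum (verts ?X) (edges ?X) (\<lambda>v. F v q) v"
      if "v \<in> verts ?X"
    proof (rule neighbour_sum_three_legs[where P = "\<lambda>j i. P j i q", OF _ _ _ _ that, symmetric])
      show "F (leg_vertex j i) q = P j i q" if "j \<in> {1, 2, 3}" for j i
        using that by (intro F) auto
      show "(q + inverse q) * P j i q = P j (Suc i) q + P j (i - 1) q"
        if "j \<in> {1, 2, 3}" "0 < i" "i \<le> (if j = 1 then a else if j = 2 then b else c)" for j i
      proof -
        obtain k where k: "i = Suc k" using \<open>0 < i\<close> gr0_implies_Suc by blast
        have "Suc (Suc (a - Suc k)) = Suc a - k" if "k < a" using that by simp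
        then show ?thesis using that rec(2)[where W = Y and k = k and q = q] rec(2)[where W = Z and k = k and q = q]
            rec(1)[where k = "a - Suc k" and q = q]
          by (auto simp: P_def k Suc_diff_Suc)
      qed
      show "P j (Suc (if j = 1 then a else if j = 2 then b else c)) q = 0" if "j \<in> {1, 2, 3}" for j
        using that last[OF q] U0 by (auto simp: P_def)
      show "(q + inverse q) * P 1 0 q = P 1 1 q + P 2 1 q + P 3 1 q"
        using rec(1)[where k = a and q = q] by (simp add: P_def V_def Z_def)
    qed
  qed
qed

section \<open>Eigenvalues and cyclotomic conditions\<close>

lemma three_term_numeral:
  "three_term x y z 2 = x * z - y"
  "three_term x y z 3 = (x ^ 2 - 1) * z - x * y"
  "three_term x y z 4 = (x ^ 3 - 2 * x) * z - (x ^ 2 - 1) * y"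
  "three_term x 0 z 5 = (x ^ 4 - 3 * x ^ 2 + 1) * z"
  "three_term x 0 z 6 = (x ^ 5 - 4 * x ^ 3 + 3 * x) * z"
  "three_term x 0 z 7 = (x ^ 6 - 5 * x ^ 4 + 6 * x ^ 2 - 1) * z"
  by (simp_all add: numeral_eq_Suc algebra_simps)

lemma cosine_eq_polynomial:
  assumes "q \<noteq> 0"
  defines "x \<equiv> q + inverse q"
  shows "2 * cosine 2 q = x ^ 2 - 2" "2 * cosine 4 q = x ^ 4 - 4 * x ^ 2 + 2"
    "2 * cosine 6 q = x ^ 6 - 6 * x ^ 4 + 9 * x ^ 2 - 2"
proof -
  have c1: "2 * cosine 1 q = x" by (simp add: cosine_def x_def)
  have step: "2 * cosine (Suc (Suc k)) q = x * (2 * cosine (Suc k) q) - 2 * cosine k q" for k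
    using cosine_step[OF assms(1), of k] by (simp add: x_def algebra_simps)
  have c2: "2 * cosine 2 q = x * (2 * cosine 1 q) - 2"
    and c3: "2 * cosine 3 q = x * (2 * cosine 2 q) - 2 * cosine 1 q"
    and c4: "2 * cosine 4 q = x * (2 * cosine 3 q) - 2 * cosine 2 q"
    and c5: "2 * cosine 5 q = x * (2 * cosine 4 q) - 2 * cosine 3 q"
    and c6: "2 * cosine 6 q = x * (2 * cosine 5 q) - 2 * cosine 4 q"
    using step[of 0] step[of 1] step[of 2] step[of 3] step[of 4] by (simp_all add: eval_nat_numeral)
  show "2 * cosine 2 q = x ^ 2 - 2" "2 * cosine 4 q = x ^ 4 - 4 * x ^ 2 + 2"
    "2 * cosine 6 q = x ^ 6 - 6 * x ^ 4 + 9 * x ^ 2 - 2"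
    unfolding c6 c5 c4 c3 c2 c1 by algebra+
qed

text \<open>
  The coefficients \<open>a0, \<dots>, a6\<close> refer to the basis \<open>1\<close> and \<open>2 cosine k\<close>, written as polynomials in \<open>x\<close>. The last summand
  is for eigenfunctions that need a separate value where \<open>x = 0\<close>, that is at the support of \<open>d' 1\<close>.
\<close>

lemma sum_eq_pairings:
  fixes m :: "complex set \<Rightarrow> real"
  assumes "0 < N" "even N"
    and f: "\<And>q x. q ^ (2 * N) = 1 \<Longrightarrow> x = q + inverse q \<Longrightarrow> f q = of_real (m {q}) *
      (a0 + a2 * (x ^ 2 - 2) + a4 * (x ^ 4 - 4 * x ^ 2 + 2) + a6 * (x ^ 6 - 6 * x ^ 4 + 9 * x ^ 2 - 2))
      + e * of_real (d' 1 {q})"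
  shows "(\<Sum>q | q ^ (2 * N) = 1. f q) = a0 * pairing N m (cosine 0) + 2 * a2 * pairing N m (cosine 2)
      + 2 * a4 * pairing N m (cosine 4) + 2 * a6 * pairing N m (cosine 6) + e"
proof -
  have "(\<Sum>q | q ^ (2 * N) = 1. f q) = pairing N m (\<lambda>q. a0 * cosine 0 q + 2 * a2 * cosine 2 q
      + 2 * a4 * cosine 4 q + 2 * a6 * cosine 6 q) + e * pairing N (d' 1) (cosine 0)"
    unfolding pairing_def sum_distrib_left sum.distrib[symmetric]
  proof (intro sum.cong refl)
    fix q :: complex assume "q \<in> {q. q ^ (2 * N) = 1}"
    then have q: "q ^ (2 * N) = 1" by simp
    note c = cosine_eq_polynomial[OF root_of_unity_unit(1)[OF assms(1) q]]
    show "f q = of_real (m {q}) * (a0 * cosine 0 q + 2 * a2 * cosine 2 q + 2 * a4 * cosine 4 q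
        + 2 * a6 * cosine 6 q) + e * (of_real (d' 1 {q}) * cosine 0 q)"
      unfolding f[OF q refl] c[symmetric] by (simp add: algebra_simps)
  qed
  also have "pairing N (d' 1) (cosine 0) = 1" using pairing_d'[OF assms(1), of 1 0] assms(2) by simp
  finally show ?thesis by (simp only: pairing_function_linear mult_1_right)
qed

text \<open>
  Cyclotomic conditions on \<open>q\<close>, translated into the factors of characteristic polynomials in the eigenvalue
  \<open>x = q + 1/q\<close>: each cyclotomic polynomial is the corresponding polynomial in \<open>x\<close> times a power of \<open>q\<close>.
\<close>

lemma polynomial_of_cyclotomic:
  fixes q :: complex
  assumes "q \<noteq> 0"
  defines "x \<equiv> q + inverse q"
  shows "q ^ 2 = 1 \<Longrightarrow> x ^ 2 = 4"
    and "q ^ 2 = - 1 \<Longrightarrow> x = 0"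
    and "q ^ 4 = - 1 \<Longrightarrow> x ^ 2 = 2"
    and "q ^ 4 + q ^ 2 + 1 = 0 \<Longrightarrow> x ^ 2 = 1"
    and "q ^ 4 - q ^ 2 + 1 = 0 \<Longrightarrow> x ^ 2 = 3"
    and "q ^ 8 + q ^ 6 + q ^ 4 + q ^ 2 + 1 = 0 \<Longrightarrow> x ^ 4 - 3 * x ^ 2 + 1 = 0"
    and "q ^ 8 - q ^ 4 + 1 = 0 \<Longrightarrow> x ^ 4 - 4 * x ^ 2 + 1 = 0"
    and "q ^ 12 - q ^ 6 + 1 = 0 \<Longrightarrow> x ^ 6 - 6 * x ^ 4 + 9 * x ^ 2 - 3 = 0"
    and "q ^ 16 + q ^ 14 - q ^ 10 - q ^ 8 - q ^ 6 + q ^ 2 + 1 = 0 \<Longrightarrow>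
      x ^ 8 - 7 * x ^ 6 + 14 * x ^ 4 - 8 * x ^ 2 + 1 = 0"
proof -
  have xq: "x * q = q ^ 2 + 1" using assms(1) by (simp add: x_def field_simps power2_eq_square)
  have "q * x = 0" if "q ^ 2 = - 1" using xq that by algebra
  then show "q ^ 2 = - 1 \<Longrightarrow> x = 0" using assms(1) by simp
  have "q ^ 2 * (x ^ 2 - 4) = 0" if "q ^ 2 = 1" using xq that by algebra
  then show "q ^ 2 = 1 \<Longrightarrow> x ^ 2 = 4" using assms(1) by simp
  have "q ^ 2 * (x ^ 2 - 2) = 0" if "q ^ 4 = - 1" using xq that by algebra
  then show "q ^ 4 = - 1 \<Longrightarrow> x ^ 2 = 2" using assms(1) by simp
  have "q ^ 2 * (x ^ 2 - 1) = 0" if "q ^ 4 + q ^ 2 + 1 = 0" using xq that by algebra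
  then show "q ^ 4 + q ^ 2 + 1 = 0 \<Longrightarrow> x ^ 2 = 1" using assms(1) by simp
  have "q ^ 2 * (x ^ 2 - 3) = 0" if "q ^ 4 - q ^ 2 + 1 = 0" using xq that by algebra
  then show "q ^ 4 - q ^ 2 + 1 = 0 \<Longrightarrow> x ^ 2 = 3" using assms(1) by simp
  define y where "y = (x * q) ^ 2"
  have y: "y = (q ^ 2 + 1) ^ 2" unfolding y_def xq ..
  have "q ^ 4 * (x ^ 4 - 3 * x ^ 2 + 1) = y ^ 2 - 3 * y * q ^ 2 + q ^ 4"
    unfolding y_def by algebra
  also have "\<dots> = q ^ 8 + q ^ 6 + q ^ 4 + q ^ 2 + 1" unfolding y by algebra
  finally show "q ^ 8 + q ^ 6 + q ^ 4 + q ^ 2 + 1 = 0 \<Longrightarrow> x ^ 4 - 3 * x ^ 2 + 1 = 0"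
    using assms(1) by simp
  have "q ^ 4 * (x ^ 4 - 4 * x ^ 2 + 1) = y ^ 2 - 4 * y * q ^ 2 + q ^ 4"
    unfolding y_def by algebra
  also have "\<dots> = q ^ 8 - q ^ 4 + 1" unfolding y by algebra
  finally show "q ^ 8 - q ^ 4 + 1 = 0 \<Longrightarrow> x ^ 4 - 4 * x ^ 2 + 1 = 0"
    using assms(1) by simp
  have "q ^ 6 * (x ^ 6 - 6 * x ^ 4 + 9 * x ^ 2 - 3) =
      y ^ 3 - 6 * y ^ 2 * q ^ 2 + 9 * y * q ^ 4 - 3 * q ^ 6"
    unfolding y_def by algebra
  also have "\<dots> = q ^ 12 - q ^ 6 + 1" unfolding y by algebra
  finally show "q ^ 12 - q ^ 6 + 1 = 0 \<Longrightarrow> x ^ 6 - 6 * x ^ 4 + 9 * x ^ 2 - 3 = 0"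
    using assms(1) by simp
  have "q ^ 8 * (x ^ 8 - 7 * x ^ 6 + 14 * x ^ 4 - 8 * x ^ 2 + 1) =
      y ^ 4 - 7 * y ^ 3 * q ^ 2 + 14 * y ^ 2 * q ^ 4 - 8 * y * q ^ 6 + q ^ 8"
    unfolding y_def by algebra
  also have "\<dots> = q ^ 16 + q ^ 14 - q ^ 10 - q ^ 8 - q ^ 6 + q ^ 2 + 1" unfolding y by algebra
  finally show "q ^ 16 + q ^ 14 - q ^ 10 - q ^ 8 - q ^ 6 + q ^ 2 + 1 = 0 \<Longrightarrow>
      x ^ 8 - 7 * x ^ 6 + 14 * x ^ 4 - 8 * x ^ 2 + 1 = 0"
    using assms(1) by simp
qed

lemma Re_square_eq:
  assumes "0 < N" "q ^ (2 * N) = 1" "(q + inverse q) ^ 2 = of_real c"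
  shows "Re (q ^ 2) = (c - 2) / 2"
proof -
  have "complex_of_real (Re (q ^ 2)) = cosine 2 q"
    using of_real_density[OF assms(1,2), of 2] by simp
  also have "\<dots> = of_real ((c - 2) / 2)"
    using cosine_eq_polynomial(1)[OF root_of_unity_unit(1)[OF assms(1,2)]] assms(3) by (simp add: mult.commute)
  finally show ?thesis unfolding of_real_eq_iff .
qed

text \<open>
  The values on the first leg at even distance from the root are sums of even cosines.
\<close>

lemma sum_three_term_from_root:
  fixes m :: "complex set \<Rightarrow> real"
  assumes "0 < N" "even N"
  shows "(\<Sum>q | q ^ (2 * N) = 1. three_term (q + inverse q) 0 (of_real (m {q})) 3) =
      pairing N m (cosine 0) + 2 * pairing N m (cosine 2)"
    and "(\<Sum>q | q ^ (2 * N) = 1. three_term (q + inverse q) 0 (of_real (m {q})) 5) =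
      pairing N m (cosine 0) + 2 * pairing N m (cosine 2) + 2 * pairing N m (cosine 4)"
proof -
  show "(\<Sum>q | q ^ (2 * N) = 1. three_term (q + inverse q) 0 (of_real (m {q})) 3) =
      pairing N m (cosine 0) + 2 * pairing N m (cosine 2)"
    by (subst sum_eq_pairings[where m = m and ?a0.0 = 1 and ?a2.0 = 1 and ?a4.0 = 0 and ?a6.0 = 0 and e = 0])
      (simp_all add: assms three_term_numeral algebra_simps)
  show "(\<Sum>q | q ^ (2 * N) = 1. three_term (q + inverse q) 0 (of_real (m {q})) 5) =
      pairing N m (cosine 0) + 2 * pairing N m (cosine 2) + 2 * pairing N m (cosine 4)"
    by (subst sum_eq_pairings[where m = m and ?a0.0 = 1 and ?a2.0 = 1 and ?a4.0 = 1 and ?a6.0 = 0 and e = 0])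
      (simp_all add: assms three_term_numeral algebra_simps)
qed

section \<open>The exceptional graphs\<close>

lemma uminus_add_inverse: "- q + inverse (- q) = - (q + inverse (q::complex))"
  by simp

lemma even_powers_uminus:
  fixes q :: complex
  shows "(- q + inverse (- q)) ^ 2 = (q + inverse q) ^ 2" "(- q + inverse (- q)) ^ 4 = (q + inverse q) ^ 4"
  unfolding uminus_add_inverse by (simp_all only: power_minus_even even_numeral power2_minus)

lemma circular_measure_E6:
  "circular_measure graph_E6 = (\<lambda>B. (d'' 2 B + 2 * weighted \<alpha> (d'' 2) B + 3 * d''' 1 B) / 6)"
proof -
  define m where "m = (\<lambda>B. (d'' 2 B + 2 * weighted \<alpha> (d'' 2) B + 3 * d''' 1 B) / 6)"
  \<comment> \<open>The eigenvalue equation \<open>x * Y q = U 3 q\<close> at the single vertex of the second leg, solved for \<open>Y q\<close>;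
    the eigenvalue \<open>x\<close> is nonzero on the support of \<open>m\<close>.\<close>
  define y where "y x = (x ^ 2 - 1) / x" for x :: complex
  define Y where "Y q = of_real (m {q}) * y (q + inverse q)" for q
  have y: "y (- x) = - y x" for x by (simp add: y_def)
  have sym: "symmetric_on_roots 12 m"
    unfolding m_def d''_def d'''_def d'_def \<alpha>_eq by (intro symmetric_on_roots_intros) auto
  have mq: "m {q} = (d'' 2 {q} + 2 * (\<alpha> q * d'' 2 {q}) + 3 * d''' 1 {q}) / 6" for q
    by (simp add: m_def weighted_singleton)
  have p: "pairing 12 m (cosine 0) = 1" "pairing 12 m (cosine 2) = - 1 / 2" "pairing 12 m (cosine 4) = 0"
    unfolding m_def d''_def d'''_def d'_def \<alpha>_eq pairing_measure_linear
      pairing_weighted_cosine[OF zero_less_numeral]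
    by (simp_all add: pairing_d flip: numeral_2_eq_2)
  \<comment> \<open>The characteristic polynomial of the graph is \<open>(x ^ 2 - 1) * (x ^ 4 - 4 * x ^ 2 + 1)\<close>. Its first
    factor vanishes at the support of \<open>d''' 1\<close>, the second one at the support of \<open>d'' 2\<close>.\<close>
  have rel: "x * Y q = of_real (m {q}) * (x ^ 2 - 1)"
    "of_real (m {q}) * ((x ^ 2 - 1) * (x ^ 4 - 4 * x ^ 2 + 1)) = 0" "x \<noteq> 0 \<or> m {q} = 0"
    if "q ^ (2 * 12) = 1" "x = q + inverse q" for q x
  proof -
    have q0: "q \<noteq> 0" using that(1) root_of_unity_unit(1)[of 12] by simp
    have *: "x ^ 4 - 4 * x ^ 2 + 1 = 0 \<or> x ^ 2 = 1" if "m {q} \<noteq> 0"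
    proof -
      have "q ^ 8 - q ^ 4 + 1 = 0 \<or> q ^ 4 + q ^ 2 + 1 = 0"
        using that by (auto simp: mq d''_singleton d'''_singleton split: if_splits)
      then show ?thesis using polynomial_of_cyclotomic(4,7)[OF q0] \<open>x = q + inverse q\<close> by blast
    qed
    show "of_real (m {q}) * ((x ^ 2 - 1) * (x ^ 4 - 4 * x ^ 2 + 1)) = 0" using * by auto
    show nz: "x \<noteq> 0 \<or> m {q} = 0" using * by (cases "m {q} = 0") auto
    show "x * Y q = of_real (m {q}) * (x ^ 2 - 1)"
      using nz unfolding Y_def y_def that(2)[symmetric] by auto
  qed
  have "circular_measure (three_legs 2 1 2) = m"
  proof (rule circular_measure_three_legs[where N = 12 and Y = Y])
    show "symmetric_on_roots 12 m" by (rule sym)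
    show "pairing 12 m (cosine 0) = 1" by (rule p)
    fix q :: complex assume q: "q ^ (2 * 12) = 1"
    define x where "x = q + inverse q"
    note r = rel[OF q x_def]
    show "0 \<le> m {q}"
      using density_nonneg[of 12 q 2] q by (simp add: mq d''_singleton d'''_singleton \<alpha>_eq)
    show "Y (- q) = (- 1) ^ (2 + 1) * Y q"
      unfolding Y_def uminus_add_inverse y symmetric_on_rootsD(2)[OF sym] by simp
    show "three_term (q + inverse q) (three_term (q + inverse q) 0 (of_real (m {q})) (2 + 1)) (Y q) (1 + 1) = 0"
      using r(1) by (simp add: three_term_numeral flip: x_def)
    have "x * ((x ^ 2 - 1) * ((x ^ 3 - 2 * x) * of_real (m {q}) - Y q)
        - x * ((x ^ 2 - 1) * of_real (m {q}))) = 0"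
      using r(1,2) by algebra
    then have "(x ^ 2 - 1) * ((x ^ 3 - 2 * x) * of_real (m {q}) - Y q)
        - x * ((x ^ 2 - 1) * of_real (m {q})) = 0"
      using r(3) by (auto simp: Y_def)
    then show "three_term (q + inverse q) (three_term (q + inverse q) 0 (of_real (m {q})) (2 + 1))
        (three_term (q + inverse q) 0 (of_real (m {q})) (2 + 2) - Y q) (2 + 1) = 0"
      by (simp add: three_term_numeral flip: x_def)
  next
    fix k :: nat
    show "(\<Sum>q | q ^ (2 * 12) = 1. three_term (q + inverse q) 0 (of_real (m {q})) k) = 0"
      if "odd k" "1 < k" "k \<le> 2 + 1"
    proof -
      have "k = 3" using that by presburger
      then show ?thesis using sum_three_term_from_root[of 12 m] p by simp
    qed
    show "(\<Sum>q | q ^ (2 * 12) = 1. three_term (q + inverse q)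
        (three_term (q + inverse q) 0 (of_real (m {q})) (2 + 1)) (Y q) k) = 0"
      if "even (2 + k)" "0 < k" "k \<le> 1" using that by presburger
    show "(\<Sum>q | q ^ (2 * 12) = 1. three_term (q + inverse q)
        (three_term (q + inverse q) 0 (of_real (m {q})) (2 + 1))
        (three_term (q + inverse q) 0 (of_real (m {q})) (2 + 2) - Y q) k) = 0"
      if "even (2 + k)" "0 < k" "k \<le> 2"
    proof -
      have "k = 2" using that by presburger
      moreover have "x * ((x ^ 3 - 2 * x) * of_real (m {q}) - Y q) - (x ^ 2 - 1) * of_real (m {q}) =
          of_real (m {q}) * (x ^ 4 - 4 * x ^ 2 + 2)"
        if "q ^ (2 * 12) = 1" "x = q + inverse q" for q x
        using rel(1)[OF that] by algebra
      ultimately show ?thesis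
        by (subst sum_eq_pairings[where m = m and ?a0.0 = 0 and ?a2.0 = 0 and ?a4.0 = 1 and ?a6.0 = 0 and e = 0])
          (simp_all add: three_term_numeral p)
    qed
  qed simp
  then show ?thesis by (simp add: graph_E6_def m_def)
qed

text \<open>
  The support consists of the primitive roots of order 36, where \<open>x ^ 6 - 6 * x ^ 4 + 9 * x ^ 2 - 3 = 0\<close>, and of
  \<open>i\<close> and \<open>-i\<close>, where \<open>x = 0\<close>.
\<close>

lemma circular_measure_E7:
  "circular_measure graph_E7 = (\<lambda>B. (2 * weighted \<beta> (d'' 3) B + d' 1 B) / 3)"
proof -
  define m where "m = (\<lambda>B. (2 * weighted \<beta> (d'' 3) B + d' 1 B) / 3)"
  \<comment> \<open>For \<open>x = q + 1/q \<noteq> 0\<close> the equation \<open>x * Y q = U 4 q\<close> at the single vertex of the second leg gives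
    the first summand. At \<open>x = 0\<close>, that is at the points \<open>i\<close> and \<open>-i\<close>, it holds for every \<open>Y q\<close>; there the
    third leg, of length two, forces \<open>Y q = U 5 q = m {q}\<close>. The second summand supplies
    \<open>3 * m {q} = d' 1 {q}\<close>, the difference to \<open>- 2 * m {q}\<close>.\<close>
  define Y where "Y q = of_real (m {q}) * ((q + inverse q) ^ 2 - 2) + of_real (d' 1 {q})" for q
  have sym: "symmetric_on_roots 18 m"
    unfolding m_def d''_def d'_def \<beta>_eq by (intro symmetric_on_roots_intros) auto
  have sym': "symmetric_on_roots 18 (d' 1)" by (rule symmetric_on_roots_d') auto
  have mq: "m {q} = (2 * (\<beta> q * d'' 3 {q}) + d' 1 {q}) / 3" for q
    by (simp add: m_def weighted_singleton)
  have p: "pairing 18 m (cosine 0) = 1" "pairing 18 m (cosine 2) = - 1 / 2" "pairing 18 m (cosine 4) = 0"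
    unfolding m_def d''_def d'_def \<beta>_eq pairing_measure_linear
      pairing_weighted_cosine[OF zero_less_numeral]
    by (simp_all add: pairing_d flip: numeral_2_eq_2)
  have rel: "x * of_real (d' 1 {q}) = 0 \<and>
      of_real (m {q}) * (x ^ 6 - 6 * x ^ 4 + 9 * x ^ 2 - 3) = (x ^ 2 - 1) * of_real (d' 1 {q})"
    if "q ^ (2 * 18) = 1" "x = q + inverse q" for q x
  proof -
    have q0: "q \<noteq> 0" using that(1) root_of_unity_unit(1)[of 18] by simp
    show ?thesis
    proof (cases "q ^ 2 = - 1")
      case True
      have "q ^ 12 = (q ^ 2) ^ 6" "q ^ 6 = (q ^ 2) ^ 3" by (simp_all flip: power_mult)
      then have "d'' 3 {q} = 0" unfolding True by (simp add: d''_singleton)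
      then have v: "d' 1 {q} = 1 / 2" "m {q} = 1 / 6" using True by (simp_all add: mq d'_singleton)
      show ?thesis unfolding v using polynomial_of_cyclotomic(2)[OF q0 True] that(2) by simp
    next
      case False
      then have D: "d' 1 {q} = 0" by (simp add: d'_singleton)
      have "q ^ 12 - q ^ 6 + 1 = 0" if "m {q} \<noteq> 0"
        using that D by (auto simp: mq d''_singleton split: if_splits)
      then have "m {q} = 0 \<or> x ^ 6 - 6 * x ^ 4 + 9 * x ^ 2 - 3 = 0"
        using polynomial_of_cyclotomic(8)[OF q0] that(2) by blast
      then show ?thesis using D by auto
    qed
  qed
  have "circular_measure (three_legs 3 1 2) = m"
  proof (rule circular_measure_three_legs[where N = 18 and Y = Y])
    show "symmetric_on_roots 18 m" by (rule sym)
    show "pairing 18 m (cosine 0) = 1" by (rule p)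
    fix q :: complex assume q: "q ^ (2 * 18) = 1"
    define x where "x = q + inverse q"
    have Yq: "Y q = of_real (m {q}) * (x ^ 2 - 2) + of_real (d' 1 {q})" by (simp add: Y_def x_def)
    note r = conjunct1[OF rel[OF q x_def]] conjunct2[OF rel[OF q x_def]]
    show "0 \<le> m {q}"
      using density_nonneg[of 18 q 4] q by (simp add: mq d''_singleton d'_singleton \<beta>_eq)
    show "Y (- q) = (- 1) ^ (3 + 1) * Y q"
      unfolding Y_def even_powers_uminus symmetric_on_rootsD(2)[OF sym] symmetric_on_rootsD(2)[OF sym']
      by simp
    have "x * Y q - (x ^ 3 - 2 * x) * of_real (m {q}) = 0" using r unfolding Yq by algebra
    then show "three_term (q + inverse q) (three_term (q + inverse q) 0 (of_real (m {q})) (3 + 1)) (Y q) (1 + 1) = 0"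
      by (simp add: three_term_numeral flip: x_def)
    have "(x ^ 2 - 1) * ((x ^ 4 - 3 * x ^ 2 + 1) * of_real (m {q}) - Y q)
        - x * ((x ^ 3 - 2 * x) * of_real (m {q})) = 0"
      using r unfolding Yq by algebra
    then show "three_term (q + inverse q) (three_term (q + inverse q) 0 (of_real (m {q})) (3 + 1))
        (three_term (q + inverse q) 0 (of_real (m {q})) (3 + 2) - Y q) (2 + 1) = 0"
      by (simp add: three_term_numeral flip: x_def)
  next
    fix k :: nat
    show "(\<Sum>q | q ^ (2 * 18) = 1. three_term (q + inverse q) 0 (of_real (m {q})) k) = 0"
      if "odd k" "1 < k" "k \<le> 3 + 1"
    proof -
      have "k = 3" using that by presburger
      then show ?thesis using sum_three_term_from_root[of 18 m] p by simp
    qed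
    show "(\<Sum>q | q ^ (2 * 18) = 1. three_term (q + inverse q)
        (three_term (q + inverse q) 0 (of_real (m {q})) (3 + 1)) (Y q) k) = 0"
      if "even (3 + k)" "0 < k" "k \<le> 1"
    proof -
      have "k = 1" using that by presburger
      then show ?thesis
        by (subst sum_eq_pairings[where m = m and ?a0.0 = 0 and ?a2.0 = 1 and ?a4.0 = 0 and ?a6.0 = 0 and e = 1])
          (simp_all add: Y_def p)
    qed
    show "(\<Sum>q | q ^ (2 * 18) = 1. three_term (q + inverse q)
        (three_term (q + inverse q) 0 (of_real (m {q})) (3 + 1))
        (three_term (q + inverse q) 0 (of_real (m {q})) (3 + 2) - Y q) k) = 0"
      if "even (3 + k)" "0 < k" "k \<le> 2"
    proof -
      have "k = 1" using that by presburger
      then show ?thesis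
        by (subst sum_eq_pairings[where m = m and ?a0.0 = 1 and ?a2.0 = 0 and ?a4.0 = 1 and ?a6.0 = 0 and e = "- 1"])
          (simp_all add: Y_def three_term_numeral p algebra_simps)
    qed
  qed simp
  then show ?thesis by (simp add: graph_E7_def m_def)
qed

lemma circular_measure_E8:
  "circular_measure graph_E8 = (\<lambda>B. (2 * weighted \<alpha> (d'' 5) B + 2 * weighted \<gamma> (d'' 5) B - d'' 1 B) / 3)"
proof -
  define m where "m = (\<lambda>B. (2 * weighted \<alpha> (d'' 5) B + 2 * weighted \<gamma> (d'' 5) B - d'' 1 B) / 3)"
  \<comment> \<open>As for \<open>E\<^sub>6\<close>, the equation \<open>x * Y q = U 5 q\<close> solved for \<open>Y q\<close>.\<close>
  define y where "y x = (x ^ 4 - 3 * x ^ 2 + 1) / x" for x :: complex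
  define Y where "Y q = of_real (m {q}) * y (q + inverse q)" for q
  have y: "y (- x) = - y x" for x by (simp add: y_def)
  have sym: "symmetric_on_roots 30 m"
    unfolding m_def d''_def d'_def \<alpha>_eq \<gamma>_eq by (intro symmetric_on_roots_intros) auto
  have mq: "m {q} = (2 * (\<alpha> q * d'' 5 {q}) + 2 * (\<gamma> q * d'' 5 {q}) - d'' 1 {q}) / 3" for q
    by (simp add: m_def weighted_singleton)
  have p: "pairing 30 m (cosine 0) = 1" "pairing 30 m (cosine 2) = - 1 / 2"
    "pairing 30 m (cosine 4) = 0" "pairing 30 m (cosine 6) = 0"
    unfolding m_def d''_def d'_def \<alpha>_eq \<gamma>_eq pairing_measure_linear
      pairing_weighted_cosine[OF zero_less_numeral]
    by (simp_all add: pairing_d flip: numeral_2_eq_2)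
  \<comment> \<open>At the primitive twelfth roots of unity, which are in the support of \<open>d'' 5\<close>, the densities
    \<open>\<alpha> = 1/2\<close> and \<open>\<gamma> = 2\<close> give the mass \<open>5/20\<close>, which \<open>d'' 1\<close> cancels. The support that
    remains consists of the primitive roots of order 60.\<close>
  have twelfth: "m {q} = 0" if "q ^ (2 * 30) = 1" "q ^ 4 - q ^ 2 + 1 = 0" for q
  proof -
    have q0: "q \<noteq> 0" using that(1) root_of_unity_unit(1)[of 30] by simp
    have q6: "q ^ 6 = - 1" using that(2) by algebra
    have "q ^ 20 - q ^ 10 + 1 = 0" using that(2) by algebra
    moreover have "Re (q ^ 2) = 1 / 2"
      using Re_square_eq[of 30 q 3] polynomial_of_cyclotomic(5)[OF q0 that(2)] that(1) by simp
    ultimately show ?thesis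
      using that(2) q6 by (simp add: mq d''_singleton \<alpha>_def \<gamma>_def)
  qed
  have rel: "x * Y q = of_real (m {q}) * (x ^ 4 - 3 * x ^ 2 + 1)"
    "of_real (m {q}) * (x ^ 8 - 7 * x ^ 6 + 14 * x ^ 4 - 8 * x ^ 2 + 1) = 0" "x \<noteq> 0 \<or> m {q} = 0"
    if "q ^ (2 * 30) = 1" "x = q + inverse q" for q x
  proof -
    have q0: "q \<noteq> 0" using that(1) root_of_unity_unit(1)[of 30] by simp
    have *: "x ^ 8 - 7 * x ^ 6 + 14 * x ^ 4 - 8 * x ^ 2 + 1 = 0" if m: "m {q} \<noteq> 0"
    proof -
      have no12: "q ^ 4 - q ^ 2 + 1 \<noteq> 0" using twelfth \<open>q ^ (2 * 30) = 1\<close> m by blast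
      moreover have "q ^ 20 - q ^ 10 + 1 = 0"
        using no12 m by (auto simp: mq d''_singleton split: if_splits)
      moreover have "q ^ 20 - q ^ 10 + 1 =
          (q ^ 4 - q ^ 2 + 1) * (q ^ 16 + q ^ 14 - q ^ 10 - q ^ 8 - q ^ 6 + q ^ 2 + 1)" by algebra
      ultimately have "q ^ 16 + q ^ 14 - q ^ 10 - q ^ 8 - q ^ 6 + q ^ 2 + 1 = 0" by simp
      then show ?thesis using polynomial_of_cyclotomic(9)[OF q0] \<open>x = q + inverse q\<close> by blast
    qed
    show "of_real (m {q}) * (x ^ 8 - 7 * x ^ 6 + 14 * x ^ 4 - 8 * x ^ 2 + 1) = 0" using * by auto
    show nz: "x \<noteq> 0 \<or> m {q} = 0" using * by (cases "m {q} = 0") auto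
    show "x * Y q = of_real (m {q}) * (x ^ 4 - 3 * x ^ 2 + 1)"
      using nz unfolding Y_def y_def that(2)[symmetric] by auto
  qed
  have "circular_measure (three_legs 4 1 2) = m"
  proof (rule circular_measure_three_legs[where N = 30 and Y = Y])
    show "symmetric_on_roots 30 m" by (rule sym)
    show "pairing 30 m (cosine 0) = 1" by (rule p)
    fix q :: complex assume q: "q ^ (2 * 30) = 1"
    define x where "x = q + inverse q"
    note r = rel[OF q x_def]
    show "0 \<le> m {q}"
    proof (cases "q ^ 4 - q ^ 2 + 1 = 0")
      case True
      then show ?thesis using twelfth[OF q] by simp
    next
      case False
      then show ?thesis
        using density_nonneg[of 30 q 2] density_nonneg[of 30 q 6] q
        by (simp add: mq d''_singleton \<alpha>_eq \<gamma>_eq)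
    qed
    show "Y (- q) = (- 1) ^ (4 + 1) * Y q"
      unfolding Y_def uminus_add_inverse y symmetric_on_rootsD(2)[OF sym] by simp
    show "three_term (q + inverse q) (three_term (q + inverse q) 0 (of_real (m {q})) (4 + 1)) (Y q) (1 + 1) = 0"
      using r(1) by (simp add: three_term_numeral flip: x_def)
    have "x * ((x ^ 2 - 1) * ((x ^ 5 - 4 * x ^ 3 + 3 * x) * of_real (m {q}) - Y q)
        - x * ((x ^ 4 - 3 * x ^ 2 + 1) * of_real (m {q}))) = 0"
      using r(1,2) by algebra
    then have "(x ^ 2 - 1) * ((x ^ 5 - 4 * x ^ 3 + 3 * x) * of_real (m {q}) - Y q)
        - x * ((x ^ 4 - 3 * x ^ 2 + 1) * of_real (m {q})) = 0"
      using r(3) by (auto simp: Y_def)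
    then show "three_term (q + inverse q) (three_term (q + inverse q) 0 (of_real (m {q})) (4 + 1))
        (three_term (q + inverse q) 0 (of_real (m {q})) (4 + 2) - Y q) (2 + 1) = 0"
      by (simp add: three_term_numeral flip: x_def)
  next
    fix k :: nat
    show "(\<Sum>q | q ^ (2 * 30) = 1. three_term (q + inverse q) 0 (of_real (m {q})) k) = 0"
      if "odd k" "1 < k" "k \<le> 4 + 1"
    proof -
      have "k = 3 \<or> k = 5" using that by presburger
      then show ?thesis
        using sum_three_term_from_root[of 30 m] p by auto
    qed
    show "(\<Sum>q | q ^ (2 * 30) = 1. three_term (q + inverse q)
        (three_term (q + inverse q) 0 (of_real (m {q})) (4 + 1)) (Y q) k) = 0"
      if "even (4 + k)" "0 < k" "k \<le> 1" using that by presburger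
    show "(\<Sum>q | q ^ (2 * 30) = 1. three_term (q + inverse q)
        (three_term (q + inverse q) 0 (of_real (m {q})) (4 + 1))
        (three_term (q + inverse q) 0 (of_real (m {q})) (4 + 2) - Y q) k) = 0"
      if "even (4 + k)" "0 < k" "k \<le> 2"
    proof -
      have "k = 2" using that by presburger
      moreover have "x * ((x ^ 5 - 4 * x ^ 3 + 3 * x) * of_real (m {q}) - Y q)
          - (x ^ 4 - 3 * x ^ 2 + 1) * of_real (m {q}) =
          of_real (m {q}) * (x ^ 6 - 6 * x ^ 4 + 9 * x ^ 2 - 2)"
        if "q ^ (2 * 30) = 1" "x = q + inverse q" for q x
        using rel(1)[OF that] by algebra
      ultimately show ?thesis
        by (subst sum_eq_pairings[where m = m and ?a0.0 = 0 and ?a2.0 = 0 and ?a4.0 = 0 and ?a6.0 = 1 and e = 0])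
          (simp_all add: three_term_numeral p)
    qed
  qed simp
  then show ?thesis by (simp add: graph_E8_def m_def)
qed

section \<open>The affine exceptional graphs\<close>

definition affine_E_measure :: "nat \<Rightarrow> complex set \<Rightarrow> real" where
  "affine_E_measure l = (\<lambda>B. weighted \<alpha> (d (l + 1)) B + (d l B - d (l + 1) B) / 2)"

lemma affine_E_measure_singleton:
  assumes "0 < l"
  shows "affine_E_measure l {q} = (if q ^ (2 * (l + 1)) = 1 then (1 / 2 - Re (q ^ 2)) / (2 * real (l + 1)) else 0)
    + (if q ^ (2 * l) = 1 then 1 / (4 * real l) else 0)"
proof -
  have "affine_E_measure l {q} = d (l + 1) {q} * (1 / 2 - Re (q ^ 2)) + d l {q} / 2"
    by (simp add: affine_E_measure_def weighted_singleton \<alpha>_def field_simps)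
  moreover have "d (l + 1) {q} = (if q ^ (2 * (l + 1)) = 1 then 1 / (2 * real (l + 1)) else 0)"
    by (rule d_singleton) simp
  ultimately show ?thesis by (simp only: d_singleton[OF assms]) auto
qed

text \<open>
  The mass at a \<open>2 (l + 1)\<close>-th root of unity different from \<open>1\<close> and \<open>-1\<close> is nonnegative if \<open>\<alpha> \<ge> 1/2\<close>, which limits \<open>l\<close> to
  at most 5. At \<open>1\<close> and \<open>-1\<close> the masses of \<open>d l\<close> and \<open>d (l + 1)\<close> combine.
\<close>

lemma affine_E_measure_nonneg:
  assumes l: "0 < l" and "q ^ (2 * (l + 1)) = 1 \<Longrightarrow> q ^ 2 = 1 \<or> Re (q ^ 2) \<le> 1 / 2"
  shows "0 \<le> affine_E_measure l {q}"
proof (cases "q ^ 2 = 1")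
  case True
  have "1 / (4 * (real l + 1)) \<le> 1 / (4 * real l)" using l by (intro divide_left_mono) auto
  moreover have "q ^ (2 * k) = 1" for k using True by (simp add: power_mult)
  ultimately show ?thesis using l True by (simp add: affine_E_measure_singleton algebra_simps)
next
  case False
  then show ?thesis using assms by (auto simp: affine_E_measure_singleton)
qed

lemma symmetric_on_roots_affine_E_measure:
  assumes "0 < N" "l dvd N" "l + 1 dvd N"
  shows "symmetric_on_roots N (affine_E_measure l)"
  unfolding affine_E_measure_def \<alpha>_eq using assms by (intro symmetric_on_roots_intros) auto

lemma pairing_affine_E_measure:
  assumes "0 < N" "l dvd N" "l + 1 dvd N"
  shows "pairing N (affine_E_measure l) (cosine k) =
    (if 2 * (l + 1) dvd k then 1 / 2 else 0) + (if 2 * l dvd k then 1 / 2 else 0)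
    - ((if 2 * (l + 1) dvd 2 + k then 1 / 2 else 0)
      + (if 2 * (l + 1) dvd (2 - k) + (k - 2) then 1 / 2 else 0))"
  unfolding affine_E_measure_def \<alpha>_eq pairing_measure_linear pairing_weighted_cosine[OF assms(1)]
    pairing_d[OF assms(1,2)] pairing_d[OF assms(1,3)] by simp

lemma power_6_eq_1_cases: "q ^ 6 = 1 \<Longrightarrow> q ^ 2 = 1 \<or> q ^ 4 + q ^ 2 + 1 = 0"
  and power_8_eq_1_cases: "q ^ 8 = 1 \<Longrightarrow> q ^ 2 = 1 \<or> q ^ 2 = - 1 \<or> q ^ 4 = - 1"
  and power_10_eq_1_cases: "q ^ 10 = 1 \<Longrightarrow> q ^ 2 = 1 \<or> q ^ 8 + q ^ 6 + q ^ 4 + q ^ 2 + 1 = 0"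
  and power_12_eq_1_cases:
    "q ^ 12 = 1 \<Longrightarrow> q ^ 2 = 1 \<or> q ^ 2 = - 1 \<or> q ^ 4 + q ^ 2 + 1 = 0 \<or> q ^ 4 - q ^ 2 + 1 = 0"
  for q :: complex
proof -
  have "(q ^ 2 - 1) * (q ^ 4 + q ^ 2 + 1) = 0" if "q ^ 6 = 1" using that by algebra
  then show "q ^ 6 = 1 \<Longrightarrow> q ^ 2 = 1 \<or> q ^ 4 + q ^ 2 + 1 = 0" by simp
  have "(q ^ 2 - 1) * ((q ^ 2 - (- 1)) * (q ^ 4 - (- 1))) = 0" if "q ^ 8 = 1" using that by algebra
  then show "q ^ 8 = 1 \<Longrightarrow> q ^ 2 = 1 \<or> q ^ 2 = - 1 \<or> q ^ 4 = - 1"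
    unfolding mult_eq_0_iff right_minus_eq by blast
  have "(q ^ 2 - 1) * (q ^ 8 + q ^ 6 + q ^ 4 + q ^ 2 + 1) = 0" if "q ^ 10 = 1" using that by algebra
  then show "q ^ 10 = 1 \<Longrightarrow> q ^ 2 = 1 \<or> q ^ 8 + q ^ 6 + q ^ 4 + q ^ 2 + 1 = 0" by simp
  have "(q ^ 2 - 1) * ((q ^ 2 - (- 1)) * ((q ^ 4 + q ^ 2 + 1) * (q ^ 4 - q ^ 2 + 1))) = 0"
    if "q ^ 12 = 1" using that by algebra
  then show "q ^ 12 = 1 \<Longrightarrow> q ^ 2 = 1 \<or> q ^ 2 = - 1 \<or> q ^ 4 + q ^ 2 + 1 = 0 \<or> q ^ 4 - q ^ 2 + 1 = 0"
    unfolding mult_eq_0_iff right_minus_eq by blast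
qed

lemma Re_square_of_cyclotomic:
  assumes "0 < N" "q ^ (2 * N) = 1"
  shows "q ^ 4 = - 1 \<Longrightarrow> Re (q ^ 2) = 0"
    and "q ^ 4 + q ^ 2 + 1 = 0 \<Longrightarrow> Re (q ^ 2) = - 1 / 2"
    and "q ^ 4 - q ^ 2 + 1 = 0 \<Longrightarrow> Re (q ^ 2) = 1 / 2"
  using Re_square_eq[OF assms, of 2] Re_square_eq[OF assms, of 1] Re_square_eq[OF assms, of 3]
    polynomial_of_cyclotomic(3-5)[OF root_of_unity_unit(1)[OF assms]] by simp_all

lemma circular_measure_affine_E6: "circular_measure affine_E6 = affine_E_measure 2"
proof -
  define m where "m = affine_E_measure 2"
  \<comment> \<open>Exchanging the second and the third leg is an automorphism that fixes the root, so both neighbours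
    of the centre on these legs have half of \<open>U 4 q\<close>.\<close>
  define y where "y x = (x ^ 3 - 2 * x) / 2" for x :: complex
  define Y where "Y q = of_real (m {q}) * y (q + inverse q)" for q
  have y: "y (- x) = - y x" for x by (simp add: y_def field_simps)
  have sym: "symmetric_on_roots 6 m"
    unfolding m_def by (rule symmetric_on_roots_affine_E_measure) auto
  have p: "pairing 6 m (cosine 0) = 1" "pairing 6 m (cosine 2) = - 1 / 2" "pairing 6 m (cosine 4) = 0"
    unfolding m_def by (subst pairing_affine_E_measure; simp flip: numeral_2_eq_2)+
  have rel: "of_real (m {q}) * (x * (x ^ 2 - 1) * (x ^ 2 - 4)) = 0"
    if "q ^ (2 * 6) = 1" "x = q + inverse q" for q x
  proof -
    have q0: "q \<noteq> 0" using that(1) root_of_unity_unit(1)[of 6] by simp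
    have "q ^ 6 = 1 \<or> q ^ 4 = 1" if "m {q} \<noteq> 0"
      using that by (auto simp: m_def affine_E_measure_singleton split: if_splits)
    moreover have "q ^ 4 = 1 \<Longrightarrow> q ^ 2 = 1 \<or> q ^ 2 = - 1"
      using power2_eq_1_iff[of "q ^ 2"] by (simp flip: power_mult)
    ultimately have "m {q} = 0 \<or> x = 0 \<or> x ^ 2 = 1 \<or> x ^ 2 = 4"
      using power_6_eq_1_cases[of q] polynomial_of_cyclotomic(1,2,4)[OF q0] that(2) by blast
    then show ?thesis by auto
  qed
  have half: "a = b * ((1 / 2) * c)" if "2 * a = b * c" for a b c :: complex
    using that by (simp add: mult.commute)
  have "circular_measure (three_legs 2 2 2) = m"
  proof (rule circular_measure_three_legs[where N = 6 and Y = Y])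
    show "symmetric_on_roots 6 m" by (rule sym)
    show "pairing 6 m (cosine 0) = 1" by (rule p)
    fix q :: complex assume q: "q ^ (2 * 6) = 1"
    define x where "x = q + inverse q"
    have Yq: "2 * Y q = of_real (m {q}) * (x ^ 3 - 2 * x)" by (simp add: Y_def y_def x_def)
    note r = rel[OF q x_def]
    show "0 \<le> m {q}"
      unfolding m_def
      by (rule affine_E_measure_nonneg)
        (use power_6_eq_1_cases[of q] Re_square_of_cyclotomic(2)[of 6 q] q in auto)
    show "Y (- q) = (- 1) ^ (2 + 1) * Y q"
      unfolding Y_def uminus_add_inverse y symmetric_on_rootsD(2)[OF sym] by simp
    have "2 * ((x ^ 2 - 1) * Y q - x * ((x ^ 2 - 1) * of_real (m {q}))) = 0"
      using r Yq by algebra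
    then have Y: "(x ^ 2 - 1) * Y q - x * ((x ^ 2 - 1) * of_real (m {q})) = 0" by simp
    then show "three_term (q + inverse q) (three_term (q + inverse q) 0 (of_real (m {q})) (2 + 1)) (Y q) (2 + 1) = 0"
      by (simp add: three_term_numeral flip: x_def)
    have "(x ^ 3 - 2 * x) * of_real (m {q}) - Y q = Y q" using Yq by algebra
    then show "three_term (q + inverse q) (three_term (q + inverse q) 0 (of_real (m {q})) (2 + 1))
        (three_term (q + inverse q) 0 (of_real (m {q})) (2 + 2) - Y q) (2 + 1) = 0"
      using Y by (simp add: three_term_numeral flip: x_def)
  next
    fix k :: nat
    show "(\<Sum>q | q ^ (2 * 6) = 1. three_term (q + inverse q) 0 (of_real (m {q})) k) = 0"
      if "odd k" "1 < k" "k \<le> 2 + 1"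
    proof -
      have "k = 3" using that by presburger
      then show ?thesis using sum_three_term_from_root[of 6 m] p by simp
    qed
    show "(\<Sum>q | q ^ (2 * 6) = 1. three_term (q + inverse q)
        (three_term (q + inverse q) 0 (of_real (m {q})) (2 + 1)) (Y q) k) = 0"
      if "even (2 + k)" "0 < k" "k \<le> 2"
    proof -
      have "k = 2" using that by presburger
      moreover have "x * Y q - (x ^ 2 - 1) * of_real (m {q}) =
          of_real (m {q}) * ((1 / 2) * (x ^ 4 - 4 * x ^ 2 + 2))" if "x = q + inverse q" for q x
      proof -
        have "2 * Y q = of_real (m {q}) * (x ^ 3 - 2 * x)" by (simp add: Y_def y_def that)
        then have "2 * (x * Y q - (x ^ 2 - 1) * of_real (m {q})) = of_real (m {q}) * (x ^ 4 - 4 * x ^ 2 + 2)"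
          by algebra
        then show ?thesis by (rule half)
      qed
      ultimately show ?thesis
        by (subst sum_eq_pairings[where m = m and ?a0.0 = 0 and ?a2.0 = 0 and ?a4.0 = "1 / 2" and ?a6.0 = 0 and e = 0])
          (simp_all add: three_term_numeral p)
    qed
    show "(\<Sum>q | q ^ (2 * 6) = 1. three_term (q + inverse q)
        (three_term (q + inverse q) 0 (of_real (m {q})) (2 + 1))
        (three_term (q + inverse q) 0 (of_real (m {q})) (2 + 2) - Y q) k) = 0"
      if "even (2 + k)" "0 < k" "k \<le> 2"
    proof -
      have "k = 2" using that by presburger
      moreover have "x * ((x ^ 3 - 2 * x) * of_real (m {q}) - Y q) - (x ^ 2 - 1) * of_real (m {q}) =
          of_real (m {q}) * ((1 / 2) * (x ^ 4 - 4 * x ^ 2 + 2))" if "x = q + inverse q" for q x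
      proof -
        have "2 * Y q = of_real (m {q}) * (x ^ 3 - 2 * x)" by (simp add: Y_def y_def that)
        then have "2 * (x * ((x ^ 3 - 2 * x) * of_real (m {q}) - Y q) - (x ^ 2 - 1) * of_real (m {q})) = of_real (m {q}) * (x ^ 4 - 4 * x ^ 2 + 2)"
          by algebra
        then show ?thesis by (rule half)
      qed
      ultimately show ?thesis
        by (subst sum_eq_pairings[where m = m and ?a0.0 = 0 and ?a2.0 = 0 and ?a4.0 = "1 / 2" and ?a6.0 = 0 and e = 0])
          (simp_all add: three_term_numeral p)
    qed
  qed simp
  then show ?thesis by (simp add: affine_E6_def m_def)
qed

lemma circular_measure_affine_E7: "circular_measure affine_E7 = affine_E_measure 3"
proof -
  define m where "m = affine_E_measure 3"
  \<comment> \<open>The eigenvalue \<open>0\<close> has multiplicity two, so at the points \<open>i\<close> and \<open>-i\<close> the equation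
    \<open>x * Y q = U 4 q\<close> and the other eigenvalue equations leave \<open>Y q\<close> free. It has to be such that the
    eigenfunction is a multiple of the projection of the unit vector at the root to the eigenspace, which
    means \<open>Y q = 2/3 * m {q}\<close>. As \<open>m {q} = 3/16\<close> there, the summand \<open>d' 1 {q} = 1/2\<close> achieves this.\<close>
  define Y where "Y q = of_real (m {q}) * ((q + inverse q) ^ 2 - 2) + of_real (d' 1 {q})" for q
  have sym: "symmetric_on_roots 12 m"
    unfolding m_def by (rule symmetric_on_roots_affine_E_measure) auto
  have sym': "symmetric_on_roots 12 (d' 1)" by (rule symmetric_on_roots_d') auto
  have p: "pairing 12 m (cosine 0) = 1" "pairing 12 m (cosine 2) = - 1 / 2" "pairing 12 m (cosine 4) = 0"
    "pairing 12 m (cosine 6) = 0"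
    unfolding m_def by (subst pairing_affine_E_measure; simp flip: numeral_2_eq_2)+
  have rel: "x * of_real (d' 1 {q}) = 0 \<and>
      of_real (m {q}) * (x * (x ^ 2 - 1) * (x ^ 2 - 2) * (x ^ 2 - 4)) = 0"
    if "q ^ (2 * 12) = 1" "x = q + inverse q" for q x
  proof -
    have q0: "q \<noteq> 0" using that(1) root_of_unity_unit(1)[of 12] by simp
    have "q ^ 8 = 1 \<or> q ^ 6 = 1" if "m {q} \<noteq> 0"
      using that by (auto simp: m_def affine_E_measure_singleton split: if_splits)
    then have "m {q} = 0 \<or> x = 0 \<or> x ^ 2 = 1 \<or> x ^ 2 = 2 \<or> x ^ 2 = 4"
      using power_6_eq_1_cases[of q] power_8_eq_1_cases[of q]
        polynomial_of_cyclotomic(1-4)[OF q0] that(2) by blast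
    moreover have "d' 1 {q} = 0 \<or> x = 0"
      using polynomial_of_cyclotomic(2)[OF q0] that(2) by (simp add: d'_singleton)
    ultimately show ?thesis by auto
  qed
  have "circular_measure (three_legs 3 1 3) = m"
  proof (rule circular_measure_three_legs[where N = 12 and Y = Y])
    show "symmetric_on_roots 12 m" by (rule sym)
    show "pairing 12 m (cosine 0) = 1" by (rule p)
    fix q :: complex assume q: "q ^ (2 * 12) = 1"
    define x where "x = q + inverse q"
    have Yq: "Y q = of_real (m {q}) * (x ^ 2 - 2) + of_real (d' 1 {q})" by (simp add: Y_def x_def)
    note r = conjunct1[OF rel[OF q x_def]] conjunct2[OF rel[OF q x_def]]
    show "0 \<le> m {q}"
      unfolding m_def
      by (rule affine_E_measure_nonneg)
        (use power_8_eq_1_cases[of q] Re_square_of_cyclotomic(1)[of 12 q] q in auto)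
    show "Y (- q) = (- 1) ^ (3 + 1) * Y q"
      unfolding Y_def even_powers_uminus symmetric_on_rootsD(2)[OF sym] symmetric_on_rootsD(2)[OF sym']
      by simp
    have "x * Y q - (x ^ 3 - 2 * x) * of_real (m {q}) = 0" using r unfolding Yq by algebra
    then show "three_term (q + inverse q) (three_term (q + inverse q) 0 (of_real (m {q})) (3 + 1)) (Y q) (1 + 1) = 0"
      by (simp add: three_term_numeral flip: x_def)
    have "(x ^ 3 - 2 * x) * ((x ^ 4 - 3 * x ^ 2 + 1) * of_real (m {q}) - Y q)
        - (x ^ 2 - 1) * ((x ^ 3 - 2 * x) * of_real (m {q})) = 0"
      using r unfolding Yq by algebra
    then show "three_term (q + inverse q) (three_term (q + inverse q) 0 (of_real (m {q})) (3 + 1))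
        (three_term (q + inverse q) 0 (of_real (m {q})) (3 + 2) - Y q) (3 + 1) = 0"
      by (simp add: three_term_numeral flip: x_def)
  next
    fix k :: nat
    show "(\<Sum>q | q ^ (2 * 12) = 1. three_term (q + inverse q) 0 (of_real (m {q})) k) = 0"
      if "odd k" "1 < k" "k \<le> 3 + 1"
    proof -
      have "k = 3" using that by presburger
      then show ?thesis using sum_three_term_from_root[of 12 m] p by simp
    qed
    show "(\<Sum>q | q ^ (2 * 12) = 1. three_term (q + inverse q)
        (three_term (q + inverse q) 0 (of_real (m {q})) (3 + 1)) (Y q) k) = 0"
      if "even (3 + k)" "0 < k" "k \<le> 1"
    proof -
      have "k = 1" using that by presburger
      then show ?thesis
        by (subst sum_eq_pairings[where m = m and ?a0.0 = 0 and ?a2.0 = 1 and ?a4.0 = 0 and ?a6.0 = 0 and e = 1])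
          (simp_all add: Y_def p)
    qed
    show "(\<Sum>q | q ^ (2 * 12) = 1. three_term (q + inverse q)
        (three_term (q + inverse q) 0 (of_real (m {q})) (3 + 1))
        (three_term (q + inverse q) 0 (of_real (m {q})) (3 + 2) - Y q) k) = 0"
      if "even (3 + k)" "0 < k" "k \<le> 3"
    proof -
      have "k = 1 \<or> k = 3" using that by presburger
      then show ?thesis
      proof
        assume "k = 1"
        then show ?thesis
          by (subst sum_eq_pairings[where m = m and ?a0.0 = 1 and ?a2.0 = 0 and ?a4.0 = 1 and ?a6.0 = 0 and e = "- 1"])
            (simp_all add: Y_def three_term_numeral p algebra_simps)
      next
        assume "k = 3"
        moreover have "(x ^ 2 - 1) * ((x ^ 4 - 3 * x ^ 2 + 1) * of_real (m {q}) - Y q)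
            - x * ((x ^ 3 - 2 * x) * of_real (m {q})) =
            of_real (m {q}) * (- 1 + (x ^ 6 - 6 * x ^ 4 + 9 * x ^ 2 - 2)) + of_real (d' 1 {q})"
          if "q ^ (2 * 12) = 1" "x = q + inverse q" for q x
        proof -
          have "Y q = of_real (m {q}) * (x ^ 2 - 2) + of_real (d' 1 {q})" by (simp add: Y_def that(2))
          then show ?thesis using conjunct1[OF rel[OF that]] by algebra
        qed
        ultimately show ?thesis
          by (subst sum_eq_pairings[where m = m and ?a0.0 = "- 1" and ?a2.0 = 0 and ?a4.0 = 0 and ?a6.0 = 1 and e = 1])
            (simp_all add: three_term_numeral p)
      qed
    qed
  qed simp
  then show ?thesis by (simp add: affine_E7_def m_def)
qed

lemma circular_measure_affine_E8: "circular_measure affine_E8 = affine_E_measure 5"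
proof -
  define m where "m = affine_E_measure 5"
  \<comment> \<open>The equation \<open>x * Y q = U 6 q\<close> gives the first summand if \<open>x = q + 1/q\<close> is nonzero. At the points
    \<open>i\<close> and \<open>-i\<close> the leg of length two forces \<open>Y q = U 7 q = - m {q}\<close> instead of \<open>3 * m {q}\<close>; the difference is
    \<open>4 * m {q} = 1/2 = d' 1 {q}\<close>.\<close>
  define Y where
    "Y q = of_real (m {q}) * ((q + inverse q) ^ 4 - 4 * (q + inverse q) ^ 2 + 3) - of_real (d' 1 {q})" for q
  have sym: "symmetric_on_roots 30 m"
    unfolding m_def by (rule symmetric_on_roots_affine_E_measure) auto
  have sym': "symmetric_on_roots 30 (d' 1)" by (rule symmetric_on_roots_d') auto
  have p: "pairing 30 m (cosine 0) = 1" "pairing 30 m (cosine 2) = - 1 / 2" "pairing 30 m (cosine 4) = 0"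
    "pairing 30 m (cosine 6) = 0"
    unfolding m_def by (subst pairing_affine_E_measure; simp flip: numeral_2_eq_2)+
  have rel: "x * of_real (d' 1 {q}) = 0 \<and>
      of_real (m {q}) * ((x ^ 2 - 1) * (x ^ 2 - 4) * (x ^ 4 - 3 * x ^ 2 + 1))
        = (1 - x ^ 2) * of_real (d' 1 {q})"
    if "q ^ (2 * 30) = 1" "x = q + inverse q" for q x
  proof -
    have q0: "q \<noteq> 0" using that(1) root_of_unity_unit(1)[of 30] by simp
    show ?thesis
    proof (cases "q ^ 2 = - 1")
      case True
      have "q ^ 12 = (q ^ 2) ^ 6" "q ^ 10 = (q ^ 2) ^ 5" by (simp_all flip: power_mult)
      then have v: "d' 1 {q} = 1 / 2" "m {q} = 1 / 8"
        unfolding True using True by (simp_all add: d'_singleton m_def affine_E_measure_singleton)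
      show ?thesis unfolding v using polynomial_of_cyclotomic(2)[OF q0 True] that(2) by simp
    next
      case False
      then have D: "d' 1 {q} = 0" by (simp add: d'_singleton)
      \<comment> \<open>The primitive twelfth roots of unity have mass zero, because \<open>\<alpha> = 1/2\<close> there.\<close>
      have "m {q} = 0" if "q ^ 4 - q ^ 2 + 1 = 0"
      proof -
        have "q ^ 10 \<noteq> 1"
        proof
          assume "q ^ 10 = 1"
          then have "(1::complex) = 0" using that by algebra
          then show False by simp
        qed
        then show ?thesis
          using Re_square_of_cyclotomic(3)[of 30 q] that \<open>q ^ (2 * 30) = 1\<close>
          by (simp add: m_def affine_E_measure_singleton)
      qed
      moreover have "q ^ 12 = 1 \<or> q ^ 10 = 1" if "m {q} \<noteq> 0"
        using that by (auto simp: m_def affine_E_measure_singleton split: if_splits)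
      ultimately have "m {q} = 0 \<or> x ^ 2 = 1 \<or> x ^ 2 = 4 \<or> x ^ 4 - 3 * x ^ 2 + 1 = 0"
        using power_10_eq_1_cases[of q] power_12_eq_1_cases[of q] False
          polynomial_of_cyclotomic(1,4,6)[OF q0] that(2) by blast
      then show ?thesis using D by auto
    qed
  qed
  have "circular_measure (three_legs 5 1 2) = m"
  proof (rule circular_measure_three_legs[where N = 30 and Y = Y])
    show "symmetric_on_roots 30 m" by (rule sym)
    show "pairing 30 m (cosine 0) = 1" by (rule p)
    fix q :: complex assume q: "q ^ (2 * 30) = 1"
    define x where "x = q + inverse q"
    have Yq: "Y q = of_real (m {q}) * (x ^ 4 - 4 * x ^ 2 + 3) - of_real (d' 1 {q})" by (simp add: Y_def x_def)
    note r = conjunct1[OF rel[OF q x_def]] conjunct2[OF rel[OF q x_def]]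
    show "0 \<le> m {q}"
      unfolding m_def
      by (rule affine_E_measure_nonneg)
        (use power_12_eq_1_cases[of q] Re_square_of_cyclotomic(2,3)[of 30 q] q in auto)
    show "Y (- q) = (- 1) ^ (5 + 1) * Y q"
      unfolding Y_def even_powers_uminus symmetric_on_rootsD(2)[OF sym] symmetric_on_rootsD(2)[OF sym']
      by simp
    have "x * Y q - (x ^ 5 - 4 * x ^ 3 + 3 * x) * of_real (m {q}) = 0" using r unfolding Yq by algebra
    then show "three_term (q + inverse q) (three_term (q + inverse q) 0 (of_real (m {q})) (5 + 1)) (Y q) (1 + 1) = 0"
      by (simp add: three_term_numeral flip: x_def)
    have "(x ^ 2 - 1) * ((x ^ 6 - 5 * x ^ 4 + 6 * x ^ 2 - 1) * of_real (m {q}) - Y q)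
        - x * ((x ^ 5 - 4 * x ^ 3 + 3 * x) * of_real (m {q})) = 0"
      using r unfolding Yq by algebra
    then show "three_term (q + inverse q) (three_term (q + inverse q) 0 (of_real (m {q})) (5 + 1))
        (three_term (q + inverse q) 0 (of_real (m {q})) (5 + 2) - Y q) (2 + 1) = 0"
      by (simp add: three_term_numeral flip: x_def)
  next
    fix k :: nat
    show "(\<Sum>q | q ^ (2 * 30) = 1. three_term (q + inverse q) 0 (of_real (m {q})) k) = 0"
      if "odd k" "1 < k" "k \<le> 5 + 1"
    proof -
      have "k = 3 \<or> k = 5" using that by presburger
      then show ?thesis using sum_three_term_from_root[of 30 m] p by auto
    qed
    show "(\<Sum>q | q ^ (2 * 30) = 1. three_term (q + inverse q)
        (three_term (q + inverse q) 0 (of_real (m {q})) (5 + 1)) (Y q) k) = 0"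
      if "even (5 + k)" "0 < k" "k \<le> 1"
    proof -
      have "k = 1" using that by presburger
      then show ?thesis
        by (subst sum_eq_pairings[where m = m and ?a0.0 = 1 and ?a2.0 = 0 and ?a4.0 = 1 and ?a6.0 = 0 and e = "- 1"])
          (simp_all add: Y_def p)
    qed
    show "(\<Sum>q | q ^ (2 * 30) = 1. three_term (q + inverse q)
        (three_term (q + inverse q) 0 (of_real (m {q})) (5 + 1))
        (three_term (q + inverse q) 0 (of_real (m {q})) (5 + 2) - Y q) k) = 0"
      if "even (5 + k)" "0 < k" "k \<le> 2"
    proof -
      have "k = 1" using that by presburger
      then show ?thesis
        by (subst sum_eq_pairings[where m = m and ?a0.0 = 0 and ?a2.0 = 1 and ?a4.0 = 0 and ?a6.0 = 1 and e = 1])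
          (simp_all add: Y_def three_term_numeral p algebra_simps)
    qed
  qed simp
  then show ?thesis by (simp add: affine_E8_def m_def)
qed

section \<open>Circular measures of the ADE graphs\<close>

theorem theorem8p7:
  shows "(\<forall>n\<ge>3. circular_measure (graph_A (n - 1)) = weighted \<alpha> (d n)) \<and>
    (\<forall>n\<ge>1. circular_measure (affine_A (2 * n)) = d n) \<and>
    (\<forall>n\<ge>2. circular_measure (graph_D (n + 1)) = weighted \<alpha> (d' n)) \<and>
    (\<forall>n\<ge>2. circular_measure (affine_D (n + 2)) = (\<lambda>B. (d n B + d' 1 B) / 2)) \<and>
    circular_measure graph_E6 =
      (\<lambda>B. (d'' 2 B + 2 * weighted \<alpha> (d'' 2) B + 3 * d''' 1 B) / 6) \<and>
    circular_measure graph_E7 = (\<lambda>B. (2 * weighted \<beta> (d'' 3) B + d' 1 B) / 3) \<and>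
    circular_measure graph_E8 =
      (\<lambda>B. (2 * weighted \<alpha> (d'' 5) B + 2 * weighted \<gamma> (d'' 5) B - d'' 1 B) / 3) \<and>
    (\<forall>(X, l) \<in> {(affine_E6, 2), (affine_E7, 3), (affine_E8, 5)}.
      circular_measure X = (\<lambda>B. weighted \<alpha> (d (l + 1)) B + (d l B - d (l + 1) B) / 2))"
proof -
  have "\<forall>(X, l) \<in> {(affine_E6, 2), (affine_E7, 3), (affine_E8, 5)}. circular_measure X = affine_E_measure l"
    using circular_measure_affine_E6 circular_measure_affine_E7 circular_measure_affine_E8 by simp
  then show ?thesis
    unfolding affine_E_measure_def
    using circular_measure_A circular_measure_affine_A circular_measure_D circular_measure_affine_D
      circular_measure_E6 circular_measure_E7 circular_measure_E8
    by blast
qed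

end
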